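(* Let $S$ be a set of primes and $Lie^S=\sum_{n\geq 1} Lie_n^S$. Then $$H[Lie^S](t) = \prod_{n\in P(S)} (1-t^n p_n)^{-1}=\sum_{\substack{\lambda\in Par\\ \lambda_i\in P(S)\ \forall i}} t^{|\lambda|} p_\lambda$$ and $$H[\omega(Lie^S)^{alt}](t)=\prod_{n\in P(S)} (1+t^n p_n)=\sum_{\substack{\lambda\in DPar\\ \lambda_i\in P(S)\ \forall i}} t^{|\lambda|} p_\lambda .$$
   Context: $h_n,p_n$ are the complete homogeneous and power-sum symmetric functions, $p_\lambda=\prod_i p_{\lambda_i}$, $\omega$ is the involution with $\omega(h_n)=e_n$, $f[g]$ is plethysm. $Par$ is the set of all integer partitions (including the empty one), $DPar$ the subset of partitions with distinct parts (including the empty one), $|\lambda|$ the size of $\lambda$. For a series $Q=\sum_{i\ge1}q_i$ with $q_i$ homogeneous of degree $i$: $H_\lambda[Q]=\prod_{i:m_i\ge1}h_{m_i}[q_i]$, where $m_i$ is the number of parts of $\lambda$ equal to $i$; $H[Q](t)=\sum_{\lambda\in Par}t^{|\lambda|}H_\lambda[Q]$ (so the coefficient of $t^n$ is the degree $n$ term of $(\sum_{r\ge0}h_r)[Q]$); and $\omega(Q)^{alt}=\sum_{i\ge1}(-1)^{i-1}\omega(q_i)$. Let $S$ be a (possibly empty or infinite) set of primes. $P(S)$ is the set of positive integers all of whose prime factors lie in $S$ (so $1\in P(S)$). For $n\ge1$, let $Q_n$ be the largest divisor of $n$ lying in $P(S)$. Let $C_n\subset S_n$ be the cyclic group generated by an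 $n$-cycle. $Lie_n^S$ is the Frobenius characteristic of the $S_n$-module induced from the linear character of $C_n$ sending the generator to $\exp(\frac{2\pi i}{n}\cdot Q_n)$. *)

theory Defs
  imports
    "HOL-Analysis.Analysis"
    "HOL-Computational_Algebra.Formal_Power_Series"
    "HOL-Combinatorics.Orbits"
    "HOL-Algebra.Sym_Groups"
    "HOL-Library.Poly_Mapping"
    "HOL-Library.Function_Algebras"
begin

section \<open>Formal power series in infinitely many variables\<close>

text \<open>
  A monomial in the variables \<open>x\<^sub>0, x\<^sub>1, \<dots>\<close> is represented by the finite multiset of the indices
  of its variables, so that the exponent of \<open>x\<^sub>i\<close> in \<open>M\<close> is \<^term>\<open>count M i\<close>, the degree of \<open>M\<close> is
  \<^term>\<open>size M\<close>, and the product of monomials is \<open>+\<close>.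
\<close>

typedef 'a mps = "UNIV :: (nat multiset \<Rightarrow> 'a) set"
  morphisms mcoeff Abs_mps ..

lemma mcoeff_Abs_mps [simp]: "mcoeff (Abs_mps f) = f"
  by (simp add: Abs_mps_inverse)

lemma mps_eqI: "(\<And>M. mcoeff f M = mcoeff g M) \<Longrightarrow> f = g"
  by (metis ext mcoeff_inject)

lemma finite_submsets [simp]: "finite {A :: 'a multiset. A \<subseteq># M}"
proof (induction M)
  case (add x M)
  have "{A. A \<subseteq># add_mset x M} \<subseteq> {A. A \<subseteq># M} \<union> add_mset x ` {A. A \<subseteq># M}"
  proof
    fix A assume "A \<in> {A. A \<subseteq># add_mset x M}"
    then have A: "A \<subseteq># add_mset x M" by simp
    show "A \<in> {A. A \<subseteq># M} \<union> add_mset x ` {A. A \<subseteq># M}"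
    proof (cases "x \<in># A")
      case True
      then have "A = add_mset x (A - {#x#})" by simp
      moreover have "A - {#x#} \<subseteq># M"
        using A by (simp add: subset_eq_diff_conv)
      ultimately show ?thesis by blast
    next
      case False
      then have "A \<subseteq># M"
        using A by (metis add_mset_add_single diff_single_trivial subset_eq_diff_conv)
      then show ?thesis by blast
    qed
  qed
  then show ?case using add.IH finite_subset by blast
qed simp

instantiation mps :: (comm_ring_1) comm_ring_1
begin

definition "0 = Abs_mps (\<lambda>M. 0)"
definition "1 = Abs_mps (\<lambda>M. if M = {#} then 1 else 0)"
definition "f + g = Abs_mps (\<lambda>M. mcoeff f M + mcoeff g M)"
definition "f - g = Abs_mps (\<lambda>M. mcoeff f M - mcoeff g M)"
definition "- f = Abs_mps (\<lambda>M. - mcoeff f M)"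
definition "f * g = Abs_mps (\<lambda>M. \<Sum>A | A \<subseteq># M. mcoeff f A * mcoeff g (M - A))"

instance
proof
  fix a b c :: "'a mps"
  show "a * b * c = a * (b * c)"
  proof (rule mps_eqI)
    fix M
    have "mcoeff (a * b * c) M =
        (\<Sum>A | A \<subseteq># M. \<Sum>B | B \<subseteq># A. mcoeff a B * mcoeff b (A - B) * mcoeff c (M - A))"
      by (simp add: times_mps_def sum_distrib_right)
    also have "\<dots> = (\<Sum>(A, B) \<in> (SIGMA A:{A. A \<subseteq># M}. {B. B \<subseteq># A}).
        mcoeff a B * mcoeff b (A - B) * mcoeff c (M - A))"
      by (rule sum.Sigma) auto
    also have "\<dots> = (\<Sum>(B, C) \<in> (SIGMA B:{B. B \<subseteq># M}. {C. C \<subseteq># M - B}).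
        mcoeff a B * (mcoeff b C * mcoeff c (M - B - C)))"
    proof (rule sum.reindex_bij_witness
        [where i = "\<lambda>(B, C). (B + C, B)" and j = "\<lambda>(A, B). (B, A - B)"])
      fix x assume "x \<in> (SIGMA A:{A. A \<subseteq># M}. {B. B \<subseteq># A})"
      then obtain A B where x: "x = (A, B)" "A \<subseteq># M" "B \<subseteq># A" by auto
      have BA: "B + (A - B) = A" using x(3) by simp
      have "A - B \<subseteq># M - B" using x by (simp add: subseteq_mset_def diff_le_mono)
      moreover have "B \<subseteq># M" using x by (meson subset_mset.order_trans)
      ultimately show "(case x of (A, B) \<Rightarrow> (B, A - B)) \<in> (SIGMA B:{B. B \<subseteq># M}. {C. C \<subseteq># M - B})"
        using x by simp
      have "M - B - (A - B) = M - A" by (metis BA diff_diff_add_mset)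
      then show "(case case x of (A, B) \<Rightarrow> (B, A - B) of (B, C) \<Rightarrow>
            mcoeff a B * (mcoeff b C * mcoeff c (M - B - C))) =
          (case x of (A, B) \<Rightarrow> mcoeff a B * mcoeff b (A - B) * mcoeff c (M - A))"
        using x by (simp add: mult.assoc)
      show "(case case x of (A, B) \<Rightarrow> (B, A - B) of (B, C) \<Rightarrow> (B + C, B)) = x"
        using x BA by simp
    next
      fix y assume "y \<in> (SIGMA B:{B. B \<subseteq># M}. {C. C \<subseteq># M - B})"
      then obtain B C where y: "y = (B, C)" "B \<subseteq># M" "C \<subseteq># M - B" by auto
      have "B + C \<subseteq># M" using y by (metis subset_mset.add_diff_inverse subset_mset.add_left_mono)
      then show "(case y of (B, C) \<Rightarrow> (B + C, B)) \<in> (SIGMA A:{A. A \<subseteq># M}. {B. B \<subseteq># A})"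
        using y by simp
      show "(case case y of (B, C) \<Rightarrow> (B + C, B) of (A, B) \<Rightarrow> (B, A - B)) = y"
        using y by simp
    qed
    also have "\<dots> = (\<Sum>B | B \<subseteq># M. \<Sum>C | C \<subseteq># M - B.
        mcoeff a B * (mcoeff b C * mcoeff c (M - B - C)))"
      by (rule sum.Sigma [symmetric]) auto
    also have "\<dots> = mcoeff (a * (b * c)) M"
      by (simp add: times_mps_def sum_distrib_left)
    finally show "mcoeff (a * b * c) M = mcoeff (a * (b * c)) M" .
  qed
  show "a * b = b * a"
  proof (rule mps_eqI)
    fix M :: "nat multiset"
    have "M - (M - A) = A" if "A \<subseteq># M" for A
      using that by (auto simp: multiset_eq_iff subseteq_mset_def)
    then show "mcoeff (a * b) M = mcoeff (b * a) M"
      unfolding times_mps_def mcoeff_Abs_mps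
      by (intro sum.reindex_bij_witness [where i = "\<lambda>A. M - A" and j = "\<lambda>A. M - A"])
         (auto simp: mult.commute)
  qed
  show "1 * a = a"
  proof (rule mps_eqI)
    fix M
    have "mcoeff (1 * a) M = (\<Sum>A | A \<subseteq># M. if A = {#} then mcoeff a M else 0)"
      unfolding times_mps_def one_mps_def mcoeff_Abs_mps by (rule sum.cong) auto
    then show "mcoeff (1 * a) M = mcoeff a M" by simp
  qed
  show "(a + b) * c = a * c + b * c"
    by (rule mps_eqI) (simp add: times_mps_def plus_mps_def distrib_right sum.distrib)
  show "(0::'a mps) \<noteq> 1"
  proof
    assume "(0::'a mps) = 1"
    then have "mcoeff (0::'a mps) {#} = mcoeff (1::'a mps) {#}" by simp
    then show False by (simp add: zero_mps_def one_mps_def)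
  qed
qed (auto intro!: mps_eqI simp: plus_mps_def zero_mps_def minus_mps_def uminus_mps_def)

end

definition mconst :: "'a::zero \<Rightarrow> 'a mps" where
  "mconst a = Abs_mps (\<lambda>M. if M = {#} then a else 0)"

section \<open>Partitions and symmetric functions\<close>

text \<open>
  A partition is the multiset of its parts; its size \<open>|\<mu>|\<close> is \<^term>\<open>\<Sum>\<^sub># \<mu>\<close>, and its number of
  parts equal to \<open>i\<close> is \<^term>\<open>count \<mu> i\<close>.
\<close>

definition Par :: "nat multiset set" where
  "Par = {\<mu>. 0 \<notin># \<mu>}"

definition DPar :: "nat multiset set" where
  "DPar = {\<mu> \<in> Par. \<forall>i. count \<mu> i \<le> 1}"

lemma finite_Par_of_size: "finite {\<mu> \<in> Par. \<Sum>\<^sub># \<mu> = n}"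
proof (rule finite_subset)
  show "{\<mu> \<in> Par. \<Sum>\<^sub># \<mu> = n} \<subseteq> mset ` {xs. set xs \<subseteq> {..n} \<and> length xs \<le> n}"
  proof
    fix l :: "nat multiset" assume l: "l \<in> {\<mu> \<in> Par. \<Sum>\<^sub># \<mu> = n}"
    obtain xs where xs: "l = mset xs" by (metis ex_mset)
    have "length xs \<le> sum_list xs" if "0 \<notin> set xs" for xs :: "nat list"
      using that by (induction xs) auto
    then have "length xs \<le> n"
      using l by (auto simp: Par_def xs sum_mset_sum_list)
    moreover have "set xs \<subseteq> {..n}"
      using l by (auto simp: xs sum_mset_sum_list member_le_sum_list)
    ultimately show "l \<in> mset ` {xs. set xs \<subseteq> {..n} \<and> length xs \<le> n}"
      using xs by blast
  qed
  show "finite (mset ` {xs. set xs \<subseteq> {..n} \<and> length xs \<le> n})"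
    by (intro finite_imageI finite_lists_length_le) simp
qed

text \<open>
  Symmetric functions (with complex coefficients) are the symmetric elements of bounded degree of
  the following ring.
\<close>

type_synonym symf = "complex mps"

definition h_fun :: "nat \<Rightarrow> symf" where
  "h_fun n = Abs_mps (\<lambda>M. if size M = n then 1 else 0)"

definition e_fun :: "nat \<Rightarrow> symf" where
  "e_fun n = Abs_mps (\<lambda>M. if size M = n \<and> (\<forall>i. count M i \<le> 1) then 1 else 0)"

definition p_fun :: "nat \<Rightarrow> symf" where
  "p_fun n = Abs_mps (\<lambda>M. if \<exists>i. M = replicate_mset n i then 1 else 0)"

text \<open>\<open>b\<^sub>\<mu> = \<Prod>\<^sub>i b\<^bsub>\<mu>\<^sub>i\<^esub>\<close> for a sequence \<open>b\<close> of symmetric functions\<close>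

definition part_prod :: "(nat \<Rightarrow> symf) \<Rightarrow> nat multiset \<Rightarrow> symf" where
  "part_prod b \<mu> = (\<Prod>i\<in>#\<mu>. b i)"

abbreviation p_part :: "nat multiset \<Rightarrow> symf" where
  "p_part \<equiv> part_prod p_fun"

definition part_comb :: "(nat \<Rightarrow> symf) \<Rightarrow> (nat multiset \<Rightarrow>\<^sub>0 complex) \<Rightarrow> symf" where
  "part_comb b c = (\<Sum>\<mu>\<in>Poly_Mapping.keys c. mconst (Poly_Mapping.lookup c \<mu>) * part_prod b \<mu>)"

text \<open>
  For algebraically independent generators \<open>b\<^sub>1, b\<^sub>2, \<dots>\<close> of the algebra of symmetric functions, the
  following is the algebra homomorphism on symmetric functions with \<open>b\<^sub>n \<mapsto> b'\<^sub>n\<close> for all \<open>n \<ge> 1\<close>: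
  it sends \<open>\<Sum>\<^sub>\<mu> c\<^sub>\<mu> b\<^sub>\<mu>\<close> to \<open>\<Sum>\<^sub>\<mu> c\<^sub>\<mu> b'\<^sub>\<mu>\<close>.
\<close>

definition gen_hom :: "(nat \<Rightarrow> symf) \<Rightarrow> (nat \<Rightarrow> symf) \<Rightarrow> symf \<Rightarrow> symf" where
  "gen_hom b b' f = (THE r. \<exists>c. Poly_Mapping.keys c \<subseteq> Par \<and> f = part_comb b c \<and> r = part_comb b' c)"

definition omega :: "symf \<Rightarrow> symf" where
  "omega = gen_hom h_fun e_fun"

text \<open>\<open>p\<^sub>n[g] = g(x\<^sub>0\<^sup>n, x\<^sub>1\<^sup>n, \<dots>)\<close> for \<open>n \<ge> 1\<close>; scalars are fixed\<close>

definition p_plethysm :: "nat \<Rightarrow> symf \<Rightarrow> symf" where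
  "p_plethysm n g = Abs_mps (\<lambda>M. if \<exists>N. M = repeat_mset n N
                                 then mcoeff g (THE N. M = repeat_mset n N) else 0)"

definition plethysm :: "symf \<Rightarrow> symf \<Rightarrow> symf" where
  "plethysm f g = gen_hom p_fun (\<lambda>n. p_plethysm n g) f"

section \<open>The series \<open>H[Q](t)\<close>\<close>

text \<open>
  A series \<open>Q = \<Sum>\<^bsub>i\<ge>1\<^esub> q\<^sub>i\<close> with \<open>q\<^sub>i\<close> homogeneous of degree \<open>i\<close> is represented by the sequence \<open>q\<close>
  of its homogeneous components; \<open>q 0\<close> is never used. The variable \<open>t\<close> is \<^term>\<open>fps_X\<close>.
\<close>

definition H_part :: "(nat \<Rightarrow> symf) \<Rightarrow> nat multiset \<Rightarrow> symf" where
  "H_part q \<mu> = (\<Prod>i\<in>set_mset \<mu>. plethysm (h_fun (count \<mu> i)) (q i))"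

definition H_series :: "(nat \<Rightarrow> symf) \<Rightarrow> symf fps" where
  "H_series q = Abs_fps (\<lambda>n. \<Sum>\<mu> | \<mu> \<in> Par \<and> \<Sum>\<^sub># \<mu> = n. H_part q \<mu>)"

definition omega_alt :: "(nat \<Rightarrow> symf) \<Rightarrow> nat \<Rightarrow> symf" where
  "omega_alt q i = (-1) ^ (i - 1) * omega (q i)"

section \<open>Induced modules and the Frobenius characteristic\<close>

interpretation cfun: vector_space "\<lambda>(c::complex) (f::'a \<Rightarrow> complex) x. c * f x"
  by unfold_locales (auto simp: fun_eq_iff algebra_simps)

text \<open>Trace of the linear map \<open>T\<close> on the finite-dimensional, \<open>T\<close>-invariant space \<open>W\<close>\<close>

definition trace_on :: "('a \<Rightarrow> complex) set \<Rightarrow> (('a \<Rightarrow> complex) \<Rightarrow> 'a \<Rightarrow> complex) \<Rightarrow> complex" where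
  "trace_on W T = (let B = (SOME B. cfun.independent B \<and> cfun.span B = W)
                   in \<Sum>b\<in>B. cfun.representation B (T b) b)"

text \<open>
  The module induced from a linear character \<open>\<psi>\<close> of a subgroup \<open>H\<close> of a finite group \<open>G\<close>: the functions
  \<open>f\<close> on \<open>G\<close> with \<open>f(hg) = \<psi>(h) f(g)\<close>, on which \<open>\<sigma> \<in> G\<close> acts by \<open>(\<sigma> f)(g) = f(g\<sigma>)\<close>. The functions are
  extended by \<open>0\<close> outside of the carrier of \<open>G\<close>.
\<close>

definition induced_module :: "('g, 'm) monoid_scheme \<Rightarrow> 'g set \<Rightarrow> ('g \<Rightarrow> complex) \<Rightarrow> ('g \<Rightarrow> complex) set" where
  "induced_module G H \<psi> = {f. (\<forall>g. g \<notin> carrier G \<longrightarrow> f g = 0) \<and>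
                              (\<forall>h\<in>H. \<forall>g\<in>carrier G. f (h \<otimes>\<^bsub>G\<^esub> g) = \<psi> h * f g)}"

definition induced_action :: "('g, 'm) monoid_scheme \<Rightarrow> 'g \<Rightarrow> ('g \<Rightarrow> complex) \<Rightarrow> 'g \<Rightarrow> complex" where
  "induced_action G \<sigma> f = (\<lambda>g. if g \<in> carrier G then f (g \<otimes>\<^bsub>G\<^esub> \<sigma>) else 0)"

definition cycle_type :: "nat \<Rightarrow> (nat \<Rightarrow> nat) \<Rightarrow> nat multiset" where
  "cycle_type n \<sigma> = image_mset card (mset_set (orbit \<sigma> ` {1..n}))"

text \<open>The Frobenius characteristic of the \<open>S\<^sub>n\<close>-module \<open>W\<close> on which \<open>\<sigma>\<close> acts by \<open>act \<sigma>\<close>\<close>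

definition frobenius_ch ::
  "nat \<Rightarrow> ('a \<Rightarrow> complex) set \<Rightarrow> ((nat \<Rightarrow> nat) \<Rightarrow> ('a \<Rightarrow> complex) \<Rightarrow> 'a \<Rightarrow> complex) \<Rightarrow> symf" where
  "frobenius_ch n W act = mconst (1 / fact n) *
     (\<Sum>\<sigma>\<in>carrier (sym_group n). mconst (trace_on W (act \<sigma>)) * p_part (cycle_type n \<sigma>))"

section \<open>The symmetric functions \<open>Lie\<^sub>n\<^sup>S\<close>\<close>

definition P_set :: "nat set \<Rightarrow> nat set" where
  "P_set S = {n. n \<ge> 1 \<and> (\<forall>p. prime p \<and> p dvd n \<longrightarrow> p \<in> S)}"

definition Q_num :: "nat set \<Rightarrow> nat \<Rightarrow> nat" where
  "Q_num S n = Max {d. d dvd n \<and> d \<in> P_set S}"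

text \<open>Up to isomorphism, the induced module does not depend on the choice of the \<open>n\<close>-cycle.\<close>

definition n_cycle :: "nat \<Rightarrow> nat \<Rightarrow> nat" where
  "n_cycle n = cycle_of_list [1..<n+1]"

definition cyclic_subgroup :: "nat \<Rightarrow> (nat \<Rightarrow> nat) set" where
  "cyclic_subgroup n = generate (sym_group n) {n_cycle n}"

definition lie_character :: "nat set \<Rightarrow> nat \<Rightarrow> (nat \<Rightarrow> nat) \<Rightarrow> complex" where
  "lie_character S n \<tau> = (THE z. \<exists>k. \<tau> = n_cycle n ^^ k \<and>
      z = exp (2 * of_real pi * \<i> / of_nat n * of_nat (Q_num S n)) ^ k)"

definition Lie :: "nat set \<Rightarrow> nat \<Rightarrow> symf" where
  "Lie S n = frobenius_ch n
     (induced_module (sym_group n) (cyclic_subgroup n) (lie_character S n))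
     (induced_action (sym_group n))"

section \<open>Inverses in a commutative ring\<close>

definition ring_inverse :: "'a::comm_ring_1 \<Rightarrow> 'a" where
  "ring_inverse a = (THE b. a * b = 1)"

end

theory Submission
  imports Defs
begin

text \<open>
  Averaging over \<open>C\<^sub>n\<close> gives \<open>n Lie\<^sub>n\<^sup>S = \<Sum>\<^sub>j \<zeta>\<^bsup>j Q\<^sub>n\<^esup> p\<^sub>d\<^sup>g\<close>, where \<open>0 \<le> j < n\<close>, \<open>g = gcd(j, n)\<close>, \<open>d = n/g\<close> and
  \<open>\<zeta> = exp(2 \<pi> i/n)\<close>. By Newton's identity for \<open>h\<^sub>n\<close>, the logarithmic derivative of \<open>H[Q](t)\<close> is determined
  by the sums \<open>\<Sum>\<^bsub>i | N\<^esub> i p\<^bsub>N/i\<^esub>[q\<^sub>i]\<close>. For \<open>Q = Lie\<^sup>S\<close>, the coefficient of \<open>p\<^sub>e\<^sup>r\<close>, \<open>e r = N\<close>, in this sum is a sum of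
  \<open>e\<close>-th roots of unity that equals \<open>e\<close> if \<open>e \<in> P(S)\<close> and vanishes otherwise, which is what the product over
  \<open>P(S)\<close> gives. Since \<open>\<omega>(p\<^sub>d) = (-1)\<^bsup>d-1\<^esup> p\<^sub>d\<close>, passing to \<open>\<omega>(Lie\<^sup>S)\<^bsup>alt\<^esup>\<close> multiplies this coefficient by
  \<open>(-1)\<^bsup>r-1\<^esup>\<close>, which turns the factors \<open>(1 - t\<^sup>n p\<^sub>n)\<^bsup>-1\<^esup>\<close> into \<open>1 + t\<^sup>n p\<^sub>n\<close>.
\<close>

section \<open>Algebra homomorphisms given on generators\<close>

text \<open>The descriptions by \<open>THE\<close> shape the algebra. \<open>gen_hom\<close> has a
  value only if the result does not depend on the polynomial chosen to represent the argument; for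
  plethysm this rests on the algebraic independence of the power sums. \<open>omega\<close> is
  described on the \<open>h_fun n\<close> instead, and its value is pinned down by a homomorphism on
  the power sums that sends each h_n to e_n. Logarithmic derivatives are treated without logarithms
  or quotients. A series with coefficients a(m) is described by a recursion m a(m) = g(1) a(m-1) +
  ... + g(m) a(0), which determines it from a(0) because positive integers are invertible scalars.
  Newton's identity is such a recursion with g(k) = p_k, and homomorphisms preserve it, so the
  factor with coefficients h_m[q_i] has g(k) = p_k[q_i]. In the variable t^i it contributes i
  p_k[q_i] at t^(ik); this is the origin of the divisor sums. The factor belonging to Lie_i^S need
  not equal the i-th factor of the product over P(S). Only the divisor sums, which mix all i,
  agree.\<close>

lemma mcoeff_zero [simp]: "mcoeff 0 M = 0"
  by (simp add: zero_mps_def)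

lemma mcoeff_one: "mcoeff 1 M = (if M = {#} then 1 else 0)"
  by (simp add: one_mps_def)

lemma mcoeff_add [simp]: "mcoeff (f + g) M = mcoeff f M + mcoeff g M"
  by (simp add: plus_mps_def)

lemma mcoeff_uminus [simp]: "mcoeff (- f) M = - mcoeff f M"
  by (simp add: uminus_mps_def)

lemma mcoeff_mult: "mcoeff (f * g) M = (\<Sum>A | A \<subseteq># M. mcoeff f A * mcoeff g (M - A))"
  by (simp add: times_mps_def)

lemma mcoeff_sum [simp]: "mcoeff (sum f A) M = (\<Sum>i\<in>A. mcoeff (f i) M)"
  by (induction A rule: infinite_finite_induct) auto

lemma mcoeff_mconst: "mcoeff (mconst a) M = (if M = {#} then a else 0)"
  by (simp add: mconst_def)

lemma mcoeff_mconst_mult [simp]: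
  fixes a :: "'a::comm_ring_1"
  shows "mcoeff (mconst a * f) M = a * mcoeff f M"
proof -
  have "mcoeff (mconst a * f) M = (\<Sum>A | A \<subseteq># M. if A = {#} then a * mcoeff f M else 0)"
    unfolding mcoeff_mult by (rule sum.cong) (auto simp: mcoeff_mconst)
  then show ?thesis by simp
qed

lemma mconst_zero [simp]: "mconst 0 = 0"
  by (rule mps_eqI) (simp add: mcoeff_mconst)

lemma mconst_one [simp]: "mconst 1 = 1"
  by (rule mps_eqI) (simp add: mcoeff_mconst mcoeff_one)

lemma mconst_add: "mconst (a + b) = mconst a + (mconst b :: 'a::comm_ring_1 mps)"
  by (rule mps_eqI) (simp add: mcoeff_mconst)

lemma mconst_mult: "mconst (a * b) = mconst a * (mconst b :: 'a::comm_ring_1 mps)"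
  by (rule mps_eqI) (simp add: mcoeff_mconst)

lemma mconst_uminus: "mconst (- a) = - (mconst a :: 'a::comm_ring_1 mps)"
  by (rule mps_eqI) (simp add: mcoeff_mconst)

lemma mconst_sum: "mconst (sum f A) = (\<Sum>i\<in>A. mconst (f i) :: 'a::comm_ring_1 mps)"
  by (induction A rule: infinite_finite_induct) (auto simp: mconst_add)

lemma mconst_power: "mconst (a ^ n) = (mconst a :: 'a::comm_ring_1 mps) ^ n"
  by (induction n) (auto simp: mconst_mult)

lemma mconst_of_nat: "mconst (of_nat n) = (of_nat n :: 'a::comm_ring_1 mps)"
  by (induction n) (auto simp: mconst_add)

lemma mconst_inverse_cancel:
  fixes f :: symf
  assumes "n > 0"
  shows "mconst (1 / of_nat n) * (of_nat n * f) = f"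
proof -
  have "mconst (1 / of_nat n) * (of_nat n * f) = mconst (1 / of_nat n * of_nat n) * f"
    unfolding mconst_mult mconst_of_nat by (rule mult.assoc [symmetric])
  then show ?thesis using assms by simp
qed

text \<open>The complex scalars contain the inverse of n. Every uniqueness argument for a recursion
  of Newton type ends with this cancellation.\<close>

lemma of_nat_symf_cancel:
  fixes f g :: symf
  assumes "of_nat n * f = of_nat n * g" "n > 0"
  shows "f = g"
  using arg_cong [OF assms(1), of "(*) (mconst (1 / of_nat n))"]
  unfolding mconst_inverse_cancel [OF assms(2)] .

section \<open>Polynomials in a sequence of symmetric functions\<close>

lemma part_prod_add: "part_prod b (\<mu> + \<nu>) = part_prod b \<mu> * part_prod b \<nu>"
  by (simp add: part_prod_def)

lemma part_comb_zero [simp]: "part_comb b 0 = 0"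
  by (simp add: part_comb_def)

lemma part_comb_single: "part_comb b (Poly_Mapping.single \<mu> a) = mconst a * part_prod b \<mu>"
  by (simp add: part_comb_def)

lemma part_comb_add: "part_comb b (c + d) = part_comb b c + part_comb b d"
  unfolding part_comb_def
  by (rule setsum_keys_plus_distrib) (simp_all add: mconst_add distrib_right)

lemma part_comb_uminus: "part_comb b (- c) = - part_comb b c"
  using part_comb_add [of b c "- c"] by (simp add: eq_neg_iff_add_eq_0 add.commute)

lemma part_comb_diff: "part_comb b (c - d) = part_comb b c - part_comb b d"
  using part_comb_add [of b c "- d"] by (simp add: part_comb_uminus)

lemma part_comb_sum: "part_comb b (sum f A) = (\<Sum>i\<in>A. part_comb b (f i))"
  by (induction A rule: infinite_finite_induct) (auto simp: part_comb_add)

lemma sum_single_keys: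
  fixes c :: "'a \<Rightarrow>\<^sub>0 'b::comm_monoid_add"
  shows "c = (\<Sum>k\<in>Poly_Mapping.keys c. Poly_Mapping.single k (Poly_Mapping.lookup c k))"
proof (rule poly_mapping_eqI)
  fix k
  show "Poly_Mapping.lookup c k = Poly_Mapping.lookup
      (\<Sum>k\<in>Poly_Mapping.keys c. Poly_Mapping.single k (Poly_Mapping.lookup c k)) k"
    by (cases "k \<in> Poly_Mapping.keys c")
       (auto simp: lookup_sum lookup_single when_def in_keys_iff)
qed

lemma part_comb_mult: "part_comb b (c * d) = part_comb b c * part_comb b d"
proof -
  let ?K = Poly_Mapping.keys and ?L = Poly_Mapping.lookup
  have "c * d = (\<Sum>\<mu>\<in>?K c. \<Sum>\<nu>\<in>?K d. Poly_Mapping.single (\<mu> + \<nu>) (?L c \<mu> * ?L d \<nu>))"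
    by (subst sum_single_keys [of c], subst sum_single_keys [of d])
       (simp add: sum_product mult_single)
  then have "part_comb b (c * d) =
      (\<Sum>\<mu>\<in>?K c. \<Sum>\<nu>\<in>?K d. (mconst (?L c \<mu>) * part_prod b \<mu>) * (mconst (?L d \<nu>) * part_prod b \<nu>))"
    by (simp add: part_comb_sum part_comb_single part_prod_add mconst_mult mult_ac)
  then show ?thesis
    by (simp add: part_comb_def sum_product)
qed

definition gen_alg :: "(nat \<Rightarrow> symf) \<Rightarrow> symf set" where
  "gen_alg b = part_comb b ` {c. Poly_Mapping.keys c \<subseteq> Par}"

lemma gen_alg_mconst: "mconst a \<in> gen_alg b"
proof -
  have "mconst a = part_comb b (Poly_Mapping.single {#} a)"
    by (simp add: part_comb_single part_prod_def)
  then show ?thesis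
    by (auto simp: gen_alg_def Par_def intro!: image_eqI)
qed

lemma gen_alg_generator: "n \<ge> 1 \<Longrightarrow> b n \<in> gen_alg b"
proof -
  assume "n \<ge> 1"
  moreover have "b n = part_comb b (Poly_Mapping.single {#n#} 1)"
    by (simp add: part_comb_single part_prod_def)
  ultimately show ?thesis
    by (auto simp: gen_alg_def Par_def intro!: image_eqI)
qed

lemma gen_alg_add:
  assumes "f \<in> gen_alg b" "g \<in> gen_alg b"
  shows "f + g \<in> gen_alg b"
proof -
  obtain c d where "Poly_Mapping.keys c \<subseteq> Par" "f = part_comb b c"
    "Poly_Mapping.keys d \<subseteq> Par" "g = part_comb b d"
    using assms by (auto simp: gen_alg_def)
  then show ?thesis
    using Poly_Mapping.keys_add [of c d]
    by (auto simp: gen_alg_def part_comb_add intro!: image_eqI [where x = "c + d"])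
qed

lemma keys_mult_Par:
  assumes "Poly_Mapping.keys c \<subseteq> Par" "Poly_Mapping.keys d \<subseteq> Par"
  shows "Poly_Mapping.keys (c * d) \<subseteq> Par"
proof
  fix \<mu> assume "\<mu> \<in> Poly_Mapping.keys (c * d)"
  then obtain a b where "\<mu> = a + b" "a \<in> Poly_Mapping.keys c" "b \<in> Poly_Mapping.keys d"
    using keys_mult [of c d] by blast
  then show "\<mu> \<in> Par"
    using assms by (auto simp: Par_def)
qed

lemma gen_alg_mult:
  assumes "f \<in> gen_alg b" "g \<in> gen_alg b"
  shows "f * g \<in> gen_alg b"
proof -
  obtain c d where "Poly_Mapping.keys c \<subseteq> Par" "f = part_comb b c"
    "Poly_Mapping.keys d \<subseteq> Par" "g = part_comb b d"
    using assms by (auto simp: gen_alg_def)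
  then show ?thesis
    using keys_mult_Par [of c d]
    by (auto simp: gen_alg_def part_comb_mult intro!: image_eqI [where x = "c * d"])
qed

lemma gen_alg_sum: "(\<And>i. i \<in> A \<Longrightarrow> f i \<in> gen_alg b) \<Longrightarrow> sum f A \<in> gen_alg b"
  by (induction A rule: infinite_finite_induct)
     (use gen_alg_mconst [of 0 b] in \<open>auto intro: gen_alg_add\<close>)

lemma gen_alg_power: "f \<in> gen_alg b \<Longrightarrow> f ^ n \<in> gen_alg b"
  by (induction n) (use gen_alg_mconst [of 1 b] in \<open>auto intro: gen_alg_mult\<close>)

lemma gen_alg_part_prod:
  assumes "\<And>i. i \<ge> 1 \<Longrightarrow> b' i \<in> gen_alg b" "\<mu> \<in> Par"
  shows "part_prod b' \<mu> \<in> gen_alg b"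
  using assms(2)
proof (induction \<mu>)
  case empty
  then show ?case using gen_alg_mconst [of 1 b] by (simp add: part_prod_def)
next
  case (add n \<mu>)
  then have "n \<ge> 1" "\<mu> \<in> Par" by (auto simp: Par_def Suc_le_eq intro!: Nat.gr0I)
  then show ?case
    using add.IH assms(1) [of n] by (simp add: part_prod_def gen_alg_mult)
qed

lemma gen_alg_subset:
  assumes "\<And>i. i \<ge> 1 \<Longrightarrow> b' i \<in> gen_alg b"
  shows "gen_alg b' \<subseteq> gen_alg b"
  using gen_alg_part_prod [where b' = b', OF assms]
  by (auto simp: gen_alg_def [of b'] part_comb_def subset_iff
      intro!: gen_alg_sum gen_alg_mult gen_alg_mconst)

text \<open>Injectivity is the uniqueness that the \<open>THE\<close> in \<open>gen_hom\<close> asks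
  for. Keys in \<open>Par\<close> avoid the index 0, where
  \<open>h_fun 0 = e_fun 0 = p_fun 0 = 1\<close> would give one function several
  representations.\<close>

definition alg_indep :: "(nat \<Rightarrow> symf) \<Rightarrow> bool" where
  "alg_indep b \<longleftrightarrow> inj_on (part_comb b) {c. Poly_Mapping.keys c \<subseteq> Par}"

lemma gen_hom_part_comb:
  assumes "alg_indep b" "Poly_Mapping.keys c \<subseteq> Par"
  shows "gen_hom b b' (part_comb b c) = part_comb b' c"
  unfolding gen_hom_def using assms
  by (intro the_equality) (auto simp: alg_indep_def inj_on_def)

lemma gen_hom_mconst:
  assumes "alg_indep b" shows "gen_hom b b' (mconst a) = mconst a"
  using gen_hom_part_comb [OF assms, of "Poly_Mapping.single {#} a" b']
  by (simp add: part_comb_single part_prod_def Par_def)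

lemma gen_hom_generator:
  assumes "alg_indep b" "n \<ge> 1" shows "gen_hom b b' (b n) = b' n"
  using gen_hom_part_comb [OF assms(1), of "Poly_Mapping.single {#n#} 1" b'] assms(2)
  by (simp add: part_comb_single part_prod_def Par_def)

lemma gen_hom_add:
  assumes "alg_indep b" "f \<in> gen_alg b" "g \<in> gen_alg b"
  shows "gen_hom b b' (f + g) = gen_hom b b' f + gen_hom b b' g"
proof -
  obtain c d where cd: "Poly_Mapping.keys c \<subseteq> Par" "f = part_comb b c"
    "Poly_Mapping.keys d \<subseteq> Par" "g = part_comb b d"
    using assms by (auto simp: gen_alg_def)
  then have "Poly_Mapping.keys (c + d) \<subseteq> Par"
    using Poly_Mapping.keys_add [of c d] by auto
  with cd show ?thesis
    by (simp add: gen_hom_part_comb assms(1) flip: part_comb_add)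
qed

lemma gen_hom_mult:
  assumes "alg_indep b" "f \<in> gen_alg b" "g \<in> gen_alg b"
  shows "gen_hom b b' (f * g) = gen_hom b b' f * gen_hom b b' g"
proof -
  obtain c d where cd: "Poly_Mapping.keys c \<subseteq> Par" "f = part_comb b c"
    "Poly_Mapping.keys d \<subseteq> Par" "g = part_comb b d"
    using assms by (auto simp: gen_alg_def)
  then show ?thesis
    by (simp add: gen_hom_part_comb assms(1) keys_mult_Par flip: part_comb_mult)
qed

lemma gen_hom_sum:
  assumes "alg_indep b" "\<And>i. i \<in> A \<Longrightarrow> f i \<in> gen_alg b"
  shows "gen_hom b b' (sum f A) = (\<Sum>i\<in>A. gen_hom b b' (f i))"
  using assms(2)
  by (induction A rule: infinite_finite_induct)
     (use gen_hom_mconst [OF assms(1), of b' 0] in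
      \<open>auto simp: gen_hom_add [OF assms(1)] gen_alg_sum\<close>)

lemma gen_hom_power:
  assumes "alg_indep b" "f \<in> gen_alg b"
  shows "gen_hom b b' (f ^ n) = gen_hom b b' f ^ n"
  by (induction n)
     (use gen_hom_mconst [OF assms(1), of b' 1] in
      \<open>auto simp: gen_hom_mult [OF assms(1)] gen_alg_power assms\<close>)

lemma gen_hom_part_prod:
  assumes "alg_indep b" "\<And>i. i \<ge> 1 \<Longrightarrow> u i \<in> gen_alg b" "\<mu> \<in> Par"
  shows "gen_hom b b' (part_prod u \<mu>) = part_prod (\<lambda>i. gen_hom b b' (u i)) \<mu>"
  using assms(3)
proof (induction \<mu>)
  case empty
  then show ?case using gen_hom_mconst [OF assms(1), of b' 1] by (simp add: part_prod_def)
next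
  case (add n \<mu>)
  then have "n \<ge> 1" "\<mu> \<in> Par" by (auto simp: Par_def Suc_le_eq intro!: Nat.gr0I)
  then show ?case
    using add.IH gen_alg_part_prod [where b' = u, OF assms(2), of \<mu>] assms(2) [of n]
    by (simp add: part_prod_def gen_hom_mult [OF assms(1)])
qed

lemma gen_hom_part_comb_other:
  assumes "alg_indep b" "\<And>i. i \<ge> 1 \<Longrightarrow> u i \<in> gen_alg b"
    "\<And>i. i \<ge> 1 \<Longrightarrow> gen_hom b b' (u i) = v i" "Poly_Mapping.keys c \<subseteq> Par"
  shows "gen_hom b b' (part_comb u c) = part_comb v c"
proof -
  have "part_prod (\<lambda>i. gen_hom b b' (u i)) \<mu> = part_prod v \<mu>" if "\<mu> \<in> Par" for \<mu>
    unfolding part_prod_def using assms(3) that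
    by (intro arg_cong [of _ _ prod_mset] image_mset_cong)
       (metis Par_def less_one mem_Collect_eq not_le)
  moreover have "part_prod u \<mu> \<in> gen_alg b" if "\<mu> \<in> Par" for \<mu>
    using gen_alg_part_prod [where b' = u, OF assms(2)] that by blast
  ultimately show ?thesis
    using assms(4) unfolding part_comb_def
    by (subst gen_hom_sum [OF assms(1)])
       (auto simp: gen_hom_mult [OF assms(1)] gen_hom_mconst [OF assms(1)] subset_iff
          gen_hom_part_prod [where u = u, OF assms(1,2)] gen_alg_mconst intro!: gen_alg_mult)
qed

text \<open>
  A homomorphism that is defined on the generators \<open>b\<close> and sends \<open>u\<^sub>n\<close> to \<open>v\<^sub>n\<close> proves that the one
  sending \<open>u\<^sub>n\<close> to \<open>v\<^sub>n\<close> is well defined, without the algebraic independence of \<open>u\<close>.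
\<close>

lemma gen_hom_change_generators:
  assumes "alg_indep b" "\<And>i. i \<ge> 1 \<Longrightarrow> u i \<in> gen_alg b"
    "\<And>i. i \<ge> 1 \<Longrightarrow> gen_hom b b' (u i) = v i" "f \<in> gen_alg u"
  shows "gen_hom u v f = gen_hom b b' f"
proof -
  obtain c where c: "Poly_Mapping.keys c \<subseteq> Par" "f = part_comb u c"
    using assms(4) by (auto simp: gen_alg_def)
  show ?thesis
    unfolding gen_hom_def [of u v]
  proof (rule the_equality)
    show "\<exists>c. Poly_Mapping.keys c \<subseteq> Par \<and> f = part_comb u c \<and> gen_hom b b' f = part_comb v c"
      using c gen_hom_part_comb_other [where u = u and v = v, OF assms(1-3)] by metis
  qed (metis gen_hom_part_comb_other [where u = u and v = v, OF assms(1-3)])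
qed

section \<open>Algebraic independence of the power sums\<close>

text \<open>For n \<ge> 1 the summands x_i^n of \<open>p_fun n\<close> are distinct monomials, so
  the convolution runs over the variables whose nth power divides \<open>M\<close>.\<close>

lemma mcoeff_p_fun_mult:
  assumes "n \<ge> 1"
  shows "mcoeff (p_fun n * f) M = (\<Sum>i | n \<le> count M i. mcoeff f (M - replicate_mset n i))"
proof -
  have inj: "inj_on (replicate_mset n) {i. n \<le> count M i}"
    using assms by (auto simp: inj_on_def replicate_mset_eq_iff)
  have "mcoeff (p_fun n * f) M =
      (\<Sum>A\<in>replicate_mset n ` {i. n \<le> count M i}. mcoeff f (M - A))"
    unfolding mcoeff_mult
    by (rule sum.mono_neutral_cong_right)
       (auto simp: p_fun_def count_le_replicate_mset_subset_eq)
  then show ?thesis by (simp add: sum.reindex [OF inj] o_def)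
qed

lemma finite_count_ge: "n \<ge> 1 \<Longrightarrow> finite {i. n \<le> count M i}"
  by (rule finite_subset [of _ "set_mset M"]) (auto simp: not_in_iff simp flip: count_greater_zero_iff)

text \<open>The exponent partition of a monomial, that is, the index of the monomial symmetric
  function in which it occurs.\<close>

definition mtype :: "nat multiset \<Rightarrow> nat multiset" where
  "mtype M = image_mset (count M) (mset_set (set_mset M))"

lemma size_mtype: "size (mtype M) = card (set_mset M)"
  by (simp add: mtype_def)

lemma mtype_remove:
  assumes "i \<in># M"
  shows "set_mset (M - replicate_mset (count M i) i) = set_mset M - {i}"
    and "mtype M = add_mset (count M i) (mtype (M - replicate_mset (count M i) i))"
proof -
  show set: "set_mset (M - replicate_mset (count M i) i) = set_mset M - {i}"
    by (auto simp: in_diff_count split: if_splits)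
  have "mset_set (set_mset M) = add_mset i (mset_set (set_mset M - {i}))"
    using assms by (simp add: mset_set.remove)
  then show "mtype M = add_mset (count M i) (mtype (M - replicate_mset (count M i) i))"
    unfolding mtype_def set by (auto intro!: image_mset_cong)
qed

lemma ex_mtype: "\<mu> \<in> Par \<Longrightarrow> \<exists>M. mtype M = \<mu>"
proof (induction \<mu>)
  case empty
  then show ?case by (auto simp: mtype_def intro: exI [of _ "{#}"])
next
  case (add n \<mu>)
  then obtain M where M: "mtype M = \<mu>" and n: "n > 0" by (auto simp: Par_def)
  obtain i where i: "i \<notin># M" using ex_new_if_finite [of "set_mset M"] by auto
  define M' where "M' = M + replicate_mset n i"
  have "count M' i = n" using i by (simp add: M'_def not_in_iff)
  moreover have "M' - replicate_mset n i = M" by (simp add: M'_def)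
  moreover have "i \<in># M'" using n by (simp add: M'_def)
  ultimately have "mtype M' = add_mset n \<mu>"
    using mtype_remove(2) [of i M'] M by simp
  then show ?case by blast
qed

text \<open>Expanding p_\<mu> assigns a variable to each part, so at most \<open>size \<mu>\<close>
  variables occur, and if that many occur, the parts have received distinct variables and are the
  exponents. The coefficients are natural numbers \<open>N M\<close>, so nothing cancels and one
  nonzero contribution suffices.\<close>

lemma mcoeff_p_part:
  assumes "\<mu> \<in> Par"
  shows "\<exists>N. \<forall>M. mcoeff (p_part \<mu>) M = of_nat (N M) \<and>
      (N M \<noteq> 0 \<longrightarrow> card (set_mset M) \<le> size \<mu> \<and> (card (set_mset M) = size \<mu> \<longrightarrow> mtype M = \<mu>)) \<and>
      (mtype M = \<mu> \<longrightarrow> N M \<noteq> 0)"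
  using assms
proof (induction \<mu>)
  case empty
  have "mtype M = {#} \<Longrightarrow> M = {#}" for M
    by (metis card_eq_0_iff finite_set_mset set_mset_eq_empty_iff size_empty size_mtype)
  then show ?case
    by (intro exI [of _ "\<lambda>M. if M = {#} then 1 else 0"])
       (auto simp: part_prod_def mcoeff_one mtype_def)
next
  case (add n \<mu>)
  then have n: "n \<ge> 1" by (auto simp: Par_def Suc_le_eq)
  obtain N where N: "\<And>M. mcoeff (p_part \<mu>) M = of_nat (N M)"
    "\<And>M. N M \<noteq> 0 \<Longrightarrow> card (set_mset M) \<le> size \<mu>"
    "\<And>M. N M \<noteq> 0 \<Longrightarrow> card (set_mset M) = size \<mu> \<Longrightarrow> mtype M = \<mu>"
    "\<And>M. mtype M = \<mu> \<Longrightarrow> N M \<noteq> 0"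
    using add by (auto simp: Par_def)
  define N' where "N' M = (\<Sum>i | n \<le> count M i. N (M - replicate_mset n i))" for M
  have "mcoeff (p_part (add_mset n \<mu>)) M = of_nat (N' M)" for M
    using mcoeff_p_fun_mult [OF n, of "p_part \<mu>" M]
    by (simp add: part_prod_def N'_def N(1) [unfolded part_prod_def])
  moreover have "card (set_mset M) \<le> Suc (size \<mu>)"
      "card (set_mset M) = Suc (size \<mu>) \<longrightarrow> mtype M = add_mset n \<mu>" if nz: "N' M \<noteq> 0" for M
  proof -
    obtain i where i: "n \<le> count M i" "N (M - replicate_mset n i) \<noteq> 0"
      using sum.not_neutral_contains_not_neutral [OF nz [unfolded N'_def]] by blast
    have iM: "i \<in># M" using i(1) n by (simp flip: count_greater_zero_iff)
    have *: "card (set_mset M) \<le> Suc (size \<mu>) \<and>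
        (card (set_mset M) = Suc (size \<mu>) \<longrightarrow> mtype M = add_mset n \<mu>)"
    \<comment> \<open>If n is the full exponent of i, then the variable i disappears and the type
      loses the part n. Otherwise the set of variables is unchanged, and the induction hypothesis
      leaves room for only \<open>size \<mu>\<close> of them.\<close>
    proof (cases "n = count M i")
      case True
      have "card (set_mset M) = Suc (card (set_mset (M - replicate_mset n i)))"
        using mtype_remove(1) [OF iM] iM True by (metis card_Suc_Diff1 finite_set_mset)
      then show ?thesis
        using mtype_remove(2) [OF iM] N(2,3) [OF i(2)] True by simp
    next
      case False
      then have "set_mset (M - replicate_mset n i) = set_mset M"
        using i(1) iM by (auto simp: in_diff_count split: if_splits)
      then show ?thesis using N(2) [OF i(2)] by simp
    qed
    then show "card (set_mset M) \<le> Suc (size \<mu>)"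
      "card (set_mset M) = Suc (size \<mu>) \<longrightarrow> mtype M = add_mset n \<mu>" by auto
  qed
  moreover have "N' M \<noteq> 0" if M: "mtype M = add_mset n \<mu>" for M
  proof -
    have "n \<in># mtype M" using M by simp
    then obtain i where i: "i \<in># M" "count M i = n" by (auto simp: mtype_def)
    then have "N (M - replicate_mset n i) \<noteq> 0"
      using mtype_remove(2) [OF i(1)] M N(4) by simp
    then show ?thesis
      unfolding N'_def using i finite_count_ge [OF n, of M] by (auto simp: sum_eq_0_iff)
  qed
  ultimately show ?case by (intro exI [of _ N']) auto
qed

text \<open>
  Triangularity: if \<open>\<mu>\<close> has the largest number of parts among the \<open>\<lambda>\<close> with \<open>c\<^sub>\<lambda> \<noteq> 0\<close>, then \<open>p\<^sub>\<mu>\<close> is the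
  only \<open>p\<^sub>\<lambda>\<close> in \<open>\<Sum>\<^sub>\<lambda> c\<^sub>\<lambda> p\<^sub>\<lambda>\<close> that contains a monomial with the exponents \<open>\<mu>\<^sub>1, \<mu>\<^sub>2, \<dots>\<close>.
\<close>

lemma part_comb_p_fun_eq_0:
  assumes keys: "Poly_Mapping.keys c \<subseteq> Par" and 0: "part_comb p_fun c = 0"
  shows "c = 0"
proof (rule ccontr)
  assume "c \<noteq> 0"
  then have "Poly_Mapping.keys c \<noteq> {}" by (metis keys_eq_empty)
  then obtain \<mu> where \<mu>: "\<mu> \<in> Poly_Mapping.keys c"
    and max: "\<And>\<nu>. \<nu> \<in> Poly_Mapping.keys c \<Longrightarrow> size \<nu> \<le> size \<mu>"
    using Max_in [of "size ` Poly_Mapping.keys c"] Max_ge [of "size ` Poly_Mapping.keys c"]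
    by (metis (no_types, lifting) finite_imageI finite_keys image_eqI image_iff image_is_empty)
  obtain M where M: "mtype M = \<mu>" using ex_mtype \<mu> keys by blast
  have other: "mcoeff (p_part \<nu>) M = 0" if \<nu>: "\<nu> \<in> Poly_Mapping.keys c" "\<nu> \<noteq> \<mu>" for \<nu>
  proof -
    obtain N where N: "mcoeff (p_part \<nu>) M = of_nat N"
      "N \<noteq> 0 \<Longrightarrow> size \<mu> \<le> size \<nu> \<and> (size \<mu> = size \<nu> \<longrightarrow> \<mu> = \<nu>)"
      using mcoeff_p_part [of \<nu>] keys \<nu>(1) M by (auto simp flip: size_mtype)
    then show ?thesis using max [OF \<nu>(1)] \<nu>(2) by (cases "N = 0") auto
  qed
  have "0 = mcoeff (part_comb p_fun c) M" by (simp add: 0)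
  also have "\<dots> = (\<Sum>\<nu>\<in>Poly_Mapping.keys c. Poly_Mapping.lookup c \<nu> * mcoeff (p_part \<nu>) M)"
    by (simp add: part_comb_def)
  also have "\<dots> = Poly_Mapping.lookup c \<mu> * mcoeff (p_part \<mu>) M"
    using \<mu> other by (subst sum.remove [OF _ \<mu>]) (auto intro!: sum.neutral)
  finally have "mcoeff (p_part \<mu>) M = 0" using \<mu> by (simp add: in_keys_iff)
  moreover obtain N where "mcoeff (p_part \<mu>) M = of_nat N" "N \<noteq> 0"
    using mcoeff_p_part [of \<mu>] keys \<mu> M by blast
  ultimately show False by simp
qed

lemma alg_indep_p_fun: "alg_indep p_fun"
  unfolding alg_indep_def
proof (rule inj_onI)
  fix c d assume cd: "c \<in> {c. Poly_Mapping.keys c \<subseteq> Par}" "d \<in> {c. Poly_Mapping.keys c \<subseteq> Par}"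
    and eq: "part_comb p_fun c = part_comb p_fun d"
  have "Poly_Mapping.keys (c - d) \<subseteq> Poly_Mapping.keys c \<union> Poly_Mapping.keys d"
    by (auto simp: in_keys_iff lookup_minus)
  then have "c - d = 0"
    using cd eq by (intro part_comb_p_fun_eq_0) (auto simp: part_comb_diff)
  then show "c = d" by simp
qed

section \<open>Newton's identities\<close>

lemma h_fun_0 [simp]: "h_fun 0 = 1"
  by (rule mps_eqI) (simp add: h_fun_def mcoeff_one)

lemma e_fun_0 [simp]: "e_fun 0 = 1"
  by (rule mps_eqI) (auto simp: e_fun_def mcoeff_one)

text \<open>Common to both Newton identities: \<open>P\<close> is trivial for h and squarefreeness
  for e. Since k \<le> m, the truncated difference m - k is exact, and splitting off x_i^k lowers
  the degree from m to m - k.\<close>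

lemma mcoeff_p_fun_mult_graded:
  assumes "1 \<le> k" "k \<le> m" and f: "\<And>A. mcoeff f A = (if size A = m - k \<and> P A then 1 else 0)"
  shows "mcoeff (p_fun k * f) M = (if size M = m then
    \<Sum>i\<in>set_mset M. if k \<le> count M i \<and> P (M - replicate_mset k i) then 1 else 0 else 0)"
proof -
  have "mcoeff (p_fun k * f) M =
      (\<Sum>i | k \<le> count M i. if size M = m \<and> P (M - replicate_mset k i) then 1 else 0)"
    unfolding mcoeff_p_fun_mult [OF assms(1)] f
  proof (rule sum.cong [OF refl])
    fix i assume "i \<in> {i. k \<le> count M i}"
    then have i: "replicate_mset k i \<subseteq># M" by (simp add: count_le_replicate_mset_subset_eq)
    have "size (M - replicate_mset k i) = size M - k" "k \<le> size M"
      using size_Diff_submset [OF i] size_mset_mono [OF i] by auto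
    then have "size (M - replicate_mset k i) = m - k \<longleftrightarrow> size M = m"
      using assms(2) by auto
    then show "(if size (M - replicate_mset k i) = m - k \<and> P (M - replicate_mset k i) then 1 else 0) =
      (if size M = m \<and> P (M - replicate_mset k i) then 1 else 0 :: complex)" by simp
  qed
  also have "\<dots> = (\<Sum>i\<in>set_mset M.
      if k \<le> count M i \<and> size M = m \<and> P (M - replicate_mset k i) then 1 else 0)"
    using assms(1)
    by (intro sum.mono_neutral_cong_left)
       (auto simp flip: count_greater_zero_iff)
  finally show ?thesis by simp
qed

text \<open>A variable of exponent c in \<open>M\<close> allows exactly the powers k = 1, ..., c to
  be split off. Over all variables this adds up to the sum of the exponents, which is the degree
  m.\<close>

lemma newton_h: "of_nat m * h_fun m = (\<Sum>k=1..m. p_fun k * h_fun (m - k))"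
proof (rule mps_eqI)
  fix M
  have "mcoeff (\<Sum>k=1..m. p_fun k * h_fun (m - k)) M = (\<Sum>k=1..m. if size M = m then
      (\<Sum>i\<in>set_mset M. if k \<le> count M i then 1 else 0) else 0)"
    unfolding mcoeff_sum
    by (intro sum.cong refl, subst mcoeff_p_fun_mult_graded [where P = "\<lambda>_. True"])
       (auto simp: h_fun_def)
  also have "\<dots> = (if size M = m then of_nat m else 0)"
  proof (cases "size M = m")
    case True
    have "(\<Sum>k=1..m. \<Sum>i\<in>set_mset M. if k \<le> count M i then 1 else 0 :: complex) =
        (\<Sum>i\<in>set_mset M. \<Sum>k=1..m. if k \<le> count M i then 1 else 0)"
      by (rule sum.swap)
    also have "\<dots> = (\<Sum>i\<in>set_mset M. of_nat (count M i))"
    proof (rule sum.cong [OF refl])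
      fix i
      have "{k \<in> {1..m}. k \<le> count M i} = {1..count M i}"
        using count_le_size [of M i] True by auto
      then show "(\<Sum>k=1..m. if k \<le> count M i then 1 else 0) = (of_nat (count M i) :: complex)"
        by (simp add: sum.If_cases Int_def conj_commute)
    qed
    also have "\<dots> = of_nat m"
      using True by (simp add: size_multiset_overloaded_eq flip: of_nat_sum)
    finally show ?thesis using True by simp
  qed simp
  finally show "mcoeff (of_nat m * h_fun m) M = mcoeff (\<Sum>k=1..m. p_fun k * h_fun (m - k)) M"
    by (simp add: h_fun_def flip: mconst_of_nat)
qed

text \<open>Splitting x_i^k off \<open>M\<close> leaves a squarefree monomial only if the other
  exponents are at most 1 and k is c or c - 1, where c is the exponent of x_i. For c \<ge> 2 the two
  signs cancel. For c = 1 the value k = 0 is out of range, so a squarefree \<open>M\<close> of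
  degree m gets a 1 from each of its m variables.\<close>

lemma newton_e: "of_nat m * e_fun m = (\<Sum>k=1..m. (-1) ^ (k - 1) * p_fun k * e_fun (m - k))"
proof (rule mps_eqI)
  fix M
  define sf :: "nat multiset \<Rightarrow> bool" where "sf M \<longleftrightarrow> (\<forall>i. count M i \<le> 1)" for M
  have sign: "mcoeff ((-1) ^ n * f) M = (-1) ^ n * mcoeff f M" for n and f :: symf
    using mcoeff_mconst_mult [of "(-1) ^ n" f M] by (simp add: mconst_power mconst_uminus)
  have "mcoeff (\<Sum>k=1..m. (-1) ^ (k - 1) * p_fun k * e_fun (m - k)) M =
      (\<Sum>k=1..m. if size M = m then (\<Sum>i\<in>set_mset M.
         if k \<le> count M i \<and> sf (M - replicate_mset k i) then (-1) ^ (k - 1) else 0) else 0)"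
    unfolding mcoeff_sum mult.assoc sign
    by (intro sum.cong refl, subst mcoeff_p_fun_mult_graded [where P = sf])
       (auto simp: e_fun_def sf_def sum_distrib_left intro!: sum.cong)
  also have "\<dots> = (if size M = m \<and> sf M then of_nat m else 0)"
  proof (cases "size M = m")
    case True
    have "(\<Sum>k=1..m. \<Sum>i\<in>set_mset M.
          if k \<le> count M i \<and> sf (M - replicate_mset k i) then (-1) ^ (k - 1) else 0 :: complex) =
        (\<Sum>i\<in>set_mset M. \<Sum>k=1..m.
          if k \<le> count M i \<and> sf (M - replicate_mset k i) then (-1) ^ (k - 1) else 0)"
      by (rule sum.swap)
    also have "\<dots> = (\<Sum>i\<in>set_mset M. if sf M then 1 else 0)"
    proof (rule sum.cong [OF refl])
      fix i assume "i \<in># M"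
      define rest where "rest \<longleftrightarrow> (\<forall>j. j \<noteq> i \<longrightarrow> count M j \<le> 1)"
      define c where "c = count M i"
      have c: "1 \<le> c" "c \<le> m"
        using \<open>i \<in># M\<close> count_le_size [of M i] True by (auto simp: c_def Suc_le_eq)
      have sf: "sf (M - replicate_mset k i) \<longleftrightarrow> rest \<and> c - k \<le> 1" for k
        by (auto simp: sf_def rest_def c_def split: if_splits)
      have sfM: "sf M \<longleftrightarrow> rest \<and> c \<le> 1"
        using sf [of 0] by simp
      have "(\<Sum>k=1..m. if k \<le> c \<and> sf (M - replicate_mset k i) then (-1) ^ (k - 1) else 0) =
          (if rest then \<Sum>k\<in>{c - 1..c} \<inter> {1..}. (-1) ^ (k - 1) else (0 :: complex))"
        using c by (auto simp: sf intro!: sum.mono_neutral_cong)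
      also have "\<dots> = (if sf M then 1 else 0)"
      proof (cases "c = 1")
        case True
        then have "{c - 1..c} \<inter> {1..} = {1}" by auto
        then show ?thesis using True by (simp add: sfM)
      next
        case False
        then obtain d where "c = Suc (Suc d)"
          using c by (metis One_nat_def Suc_le_D le_antisym not_less_eq_eq old.nat.exhaust)
        moreover from this have "{c - 1..c} \<inter> {1..} = {Suc d, Suc (Suc d)}" by auto
        ultimately show ?thesis by (simp add: sfM)
      qed
      finally show "(\<Sum>k=1..m. if k \<le> count M i \<and> sf (M - replicate_mset k i)
          then (-1) ^ (k - 1) else 0) = (if sf M then 1 else 0 :: complex)"
        by (simp add: c_def)
    qed
    also have "\<dots> = (if sf M then of_nat m else 0)"
    proof (cases "sf M")
      case sf: True
      have "count M i = 1" if "i \<in># M" for i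
        using that sf by (metis count_greater_eq_one_iff le_antisym sf_def)
      then have "card (set_mset M) = size M" by (simp add: size_multiset_overloaded_eq)
      with sf True show ?thesis by simp
    qed simp
    finally show ?thesis using True by simp
  qed simp
  finally show "mcoeff (of_nat m * e_fun m) M =
      mcoeff (\<Sum>k=1..m. (-1) ^ (k - 1) * p_fun k * e_fun (m - k)) M"
    by (simp add: e_fun_def sf_def flip: mconst_of_nat)
qed

section \<open>Consequences of Newton's identities for omega and plethysm\<close>

lemma newton_unique:
  fixes f g :: "nat \<Rightarrow> symf"
  assumes "\<And>m. m \<ge> 1 \<Longrightarrow> of_nat m * f m = (\<Sum>k=1..m. a k * f (m - k))"
    and "\<And>m. m \<ge> 1 \<Longrightarrow> of_nat m * g m = (\<Sum>k=1..m. a k * g (m - k))" and "f 0 = g 0"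
  shows "f m = g m"
proof (induction m rule: less_induct)
  case (less m)
  show ?case
  proof (cases "m = 0")
    case False
    then have "of_nat m * f m = of_nat m * g m"
      using less by (simp add: assms(1,2))
    then show ?thesis using of_nat_symf_cancel False by blast
  qed (use assms(3) in simp)
qed

lemma h_fun_in_gen_alg_p: "h_fun n \<in> gen_alg p_fun"
proof (induction n rule: less_induct)
  case (less n)
  show ?case
  proof (cases "n = 0")
    case True
    then show ?thesis using gen_alg_mconst [of 1 p_fun] by simp
  next
    case False
    then have "h_fun n = mconst (1 / of_nat n) * (of_nat n * h_fun n)"
      by (simp add: mconst_inverse_cancel)
    also have "\<dots> \<in> gen_alg p_fun"
      unfolding newton_h using less
      by (intro gen_alg_mult gen_alg_mconst gen_alg_sum gen_alg_generator) auto
    finally show ?thesis .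
  qed
qed

text \<open>Newton's identity solved for its last term \<open>p_fun n * h_fun 0\<close>, which has
  coefficient 1.\<close>

lemma p_fun_in_gen_alg_h: "n \<ge> 1 \<Longrightarrow> p_fun n \<in> gen_alg h_fun"
proof (induction n rule: less_induct)
  case (less n)
  have "of_nat n * h_fun n = (\<Sum>k=1..<n. p_fun k * h_fun (n - k)) + p_fun n"
    using less.prems by (simp add: newton_h sum.last_plus)
  then have "p_fun n = mconst (of_nat n) * h_fun n + mconst (- 1) * (\<Sum>k=1..<n. p_fun k * h_fun (n - k))"
    by (simp add: mconst_of_nat mconst_uminus)
  also have "\<dots> \<in> gen_alg h_fun"
    using less by (intro gen_alg_add gen_alg_mult gen_alg_mconst gen_alg_sum gen_alg_generator) auto
  finally show ?case .
qed

text \<open>Serves twice: \<open>b k = (-1) ^ (k - 1) * p_fun k\<close> gives the recursion of e and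
  thereby omega, and \<open>b k = p_plethysm k q\<close> gives the recursion of h_m[q].\<close>

lemma newton_gen_hom_h_fun:
  "of_nat m * gen_hom p_fun b (h_fun m) = (\<Sum>k=1..m. b k * gen_hom p_fun b (h_fun (m - k)))"
proof -
  note ai = alg_indep_p_fun
  have "of_nat m * gen_hom p_fun b (h_fun m) = gen_hom p_fun b (of_nat m * h_fun m)"
    by (simp add: gen_hom_mult gen_hom_mconst ai gen_alg_mconst h_fun_in_gen_alg_p flip: mconst_of_nat)
  also have "\<dots> = (\<Sum>k=1..m. gen_hom p_fun b (p_fun k) * gen_hom p_fun b (h_fun (m - k)))"
    unfolding newton_h
    by (subst gen_hom_sum [OF ai])
       (auto simp: gen_hom_mult [OF ai] gen_alg_mult gen_alg_generator h_fun_in_gen_alg_p)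
  finally show ?thesis by (simp add: gen_hom_generator [OF ai])
qed

lemma gen_hom_p_fun_h_fun_0: "gen_hom p_fun b (h_fun 0) = 1"
  using gen_hom_mconst [OF alg_indep_p_fun, of b 1] by simp

text \<open>The homomorphism on the right sends \<open>h_fun i\<close> to \<open>e_fun i\<close>,
  since both sequences satisfy the same signed Newton recursion. On power sums omega is only a sign,
  which makes it computable on \<open>Lie\<close>.\<close>

lemma omega_eq:
  assumes "f \<in> gen_alg p_fun"
  shows "omega f = gen_hom p_fun (\<lambda>n. (-1) ^ (n - 1) * p_fun n) f"
  unfolding omega_def
proof (rule gen_hom_change_generators [OF alg_indep_p_fun])
  show "f \<in> gen_alg h_fun"
    using gen_alg_subset [of p_fun h_fun] p_fun_in_gen_alg_h assms by blast
  show "gen_hom p_fun (\<lambda>n. (-1) ^ (n - 1) * p_fun n) (h_fun i) = e_fun i" for i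
    by (rule newton_unique [where a = "\<lambda>n. (-1) ^ (n - 1) * p_fun n"])
       (use gen_hom_p_fun_h_fun_0 in \<open>simp_all add: newton_e newton_gen_hom_h_fun\<close>)
qed (rule h_fun_in_gen_alg_p)

lemma newton_plethysm_h_fun:
  "of_nat m * plethysm (h_fun m) q = (\<Sum>k=1..m. p_plethysm k q * plethysm (h_fun (m - k)) q)"
  unfolding plethysm_def by (rule newton_gen_hom_h_fun)

lemma plethysm_h_fun_0: "plethysm (h_fun 0) q = 1"
  unfolding plethysm_def by (rule gen_hom_p_fun_h_fun_0)

section \<open>The plethysm by a power sum\<close>

lemma p_plethysm_repeat:
  assumes "k \<ge> 1"
  shows "mcoeff (p_plethysm k f) (repeat_mset k N) = mcoeff f N"
proof -
  have "(THE N'. repeat_mset k N = repeat_mset k N') = N"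
    using assms by (intro the_equality) (auto simp: repeat_mset_cancel1)
  then show ?thesis by (auto simp: p_plethysm_def)
qed

lemma p_plethysm_not_repeat: "\<nexists>N. M = repeat_mset k N \<Longrightarrow> mcoeff (p_plethysm k f) M = 0"
  by (simp add: p_plethysm_def)

lemma p_plethysm_eqI:
  assumes "k \<ge> 1" "\<And>N. mcoeff f (repeat_mset k N) = mcoeff g N"
    "\<And>M. \<nexists>N. M = repeat_mset k N \<Longrightarrow> mcoeff f M = 0"
  shows "p_plethysm k g = f"
proof (rule mps_eqI)
  fix M show "mcoeff (p_plethysm k g) M = mcoeff f M"
    using assms by (cases "\<exists>N. M = repeat_mset k N") (auto simp: p_plethysm_not_repeat p_plethysm_repeat)
qed

lemma p_plethysm_sum: "k \<ge> 1 \<Longrightarrow> p_plethysm k (sum f A) = (\<Sum>i\<in>A. p_plethysm k (f i))"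
  by (rule p_plethysm_eqI) (auto simp: p_plethysm_not_repeat p_plethysm_repeat)

lemma repeat_mset_subset_iff: "k \<ge> 1 \<Longrightarrow> repeat_mset k A \<subseteq># repeat_mset k B \<longleftrightarrow> A \<subseteq># B"
  by (simp add: subseteq_mset_def)

lemma repeat_mset_diff: "repeat_mset k (A - B) = repeat_mset k A - repeat_mset k B"
  by (rule multiset_eqI) (simp add: diff_mult_distrib2)

text \<open>Only factorizations of a monomial into two kth powers contribute. For the kth power of
  \<open>N\<close> they correspond to the factorizations of \<open>N\<close>; a monomial that is not
  a kth power has none.\<close>

lemma p_plethysm_mult:
  assumes k: "k \<ge> 1"
  shows "p_plethysm k (f * g) = p_plethysm k f * p_plethysm k g"
proof (rule p_plethysm_eqI [OF k])
  fix N :: "nat multiset"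
  have inj: "inj_on (repeat_mset k) {B. B \<subseteq># N}"
    using k by (auto simp: inj_on_def repeat_mset_cancel1)
  have "mcoeff (p_plethysm k f * p_plethysm k g) (repeat_mset k N) =
      (\<Sum>A\<in>repeat_mset k ` {B. B \<subseteq># N}.
         mcoeff (p_plethysm k f) A * mcoeff (p_plethysm k g) (repeat_mset k N - A))"
    unfolding mcoeff_mult
  proof (rule sum.mono_neutral_right)
    show "\<forall>A\<in>{A. A \<subseteq># repeat_mset k N} - repeat_mset k ` {B. B \<subseteq># N}.
        mcoeff (p_plethysm k f) A * mcoeff (p_plethysm k g) (repeat_mset k N - A) = 0"
    proof
      fix A assume A: "A \<in> {A. A \<subseteq># repeat_mset k N} - repeat_mset k ` {B. B \<subseteq># N}"
      then have "\<nexists>B. A = repeat_mset k B" using repeat_mset_subset_iff [OF k] by auto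
      then show "mcoeff (p_plethysm k f) A * mcoeff (p_plethysm k g) (repeat_mset k N - A) = 0"
        by (simp add: p_plethysm_not_repeat)
    qed
  qed (auto simp: repeat_mset_subset_iff [OF k])
  also have "\<dots> = mcoeff (f * g) N"
    by (simp add: sum.reindex [OF inj] mcoeff_mult p_plethysm_repeat [OF k] flip: repeat_mset_diff)
  finally show "mcoeff (p_plethysm k f * p_plethysm k g) (repeat_mset k N) = mcoeff (f * g) N" .
next
  fix M :: "nat multiset" assume M: "\<nexists>N. M = repeat_mset k N"
  show "mcoeff (p_plethysm k f * p_plethysm k g) M = 0"
    unfolding mcoeff_mult
  proof (intro sum.neutral ballI)
    fix A assume "A \<in> {A. A \<subseteq># M}"
    then have "M = A + (M - A)" by simp
    then have "\<not> ((\<exists>B. A = repeat_mset k B) \<and> (\<exists>C. M - A = repeat_mset k C))"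
      using M by (metis repeat_mset_distrib2)
    then show "mcoeff (p_plethysm k f) A * mcoeff (p_plethysm k g) (M - A) = 0"
      by (auto simp: p_plethysm_not_repeat)
  qed
qed

lemma p_plethysm_mconst: "k \<ge> 1 \<Longrightarrow> p_plethysm k (mconst a) = mconst a"
  by (rule p_plethysm_eqI) (auto simp: mcoeff_mconst repeat_mset_eq_empty_iff dest: spec [of _ "{#}"])

lemma p_plethysm_power: "k \<ge> 1 \<Longrightarrow> p_plethysm k (f ^ n) = p_plethysm k f ^ n"
  using p_plethysm_mconst [of k 1] by (induction n) (auto simp: p_plethysm_mult)

lemma repeat_replicate_mset: "repeat_mset k (replicate_mset n i) = replicate_mset (k * n) i"
  by (rule multiset_eqI) auto

lemma p_plethysm_p_fun: "k \<ge> 1 \<Longrightarrow> p_plethysm k (p_fun n) = p_fun (k * n)"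
proof (rule p_plethysm_eqI)
  assume k: "k \<ge> 1"
  have "repeat_mset k N = replicate_mset (k * n) i \<longleftrightarrow> N = replicate_mset n i" for N and i :: nat
    unfolding repeat_replicate_mset [symmetric] using k by (simp add: repeat_mset_cancel1)
  then show "mcoeff (p_fun (k * n)) (repeat_mset k N) = mcoeff (p_fun n) N" for N
    by (simp add: p_fun_def)
  show "mcoeff (p_fun (k * n)) M = 0" if "\<nexists>N. M = repeat_mset k N" for M
    using that by (auto simp: p_fun_def simp flip: repeat_replicate_mset)
qed

section \<open>Euler products of formal power series\<close>

text \<open>\<open>a i m\<close> is the weight of having exactly m parts equal to i. Parts that do
  not occur contribute the factor 1, which matches the Euler product when
  \<open>a i 0 = 1\<close>.\<close>

definition part_weight :: "(nat \<Rightarrow> nat \<Rightarrow> 'r) \<Rightarrow> nat multiset \<Rightarrow> 'r::comm_ring_1" where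
  "part_weight a \<mu> = (\<Prod>i\<in>set_mset \<mu>. a i (count \<mu> i))"

text \<open>For i \<ge> 1 this is the series
  \<open>a i 0 + a i 1 * t^i + a i 2 * t^(2*i) + ...\<close>.\<close>

definition euler_factor :: "(nat \<Rightarrow> nat \<Rightarrow> 'r) \<Rightarrow> nat \<Rightarrow> 'r::comm_ring_1 fps" where
  "euler_factor a i = Abs_fps (\<lambda>n. if i dvd n then a i (n div i) else 0)"

definition euler_series :: "(nat \<Rightarrow> nat \<Rightarrow> 'r) \<Rightarrow> 'r::comm_ring_1 fps" where
  "euler_series a = Abs_fps (\<lambda>n. \<Sum>\<mu> | \<mu> \<in> Par \<and> \<Sum>\<^sub># \<mu> = n. part_weight a \<mu>)"

lemma finite_parts_upto: "finite {\<mu>. set_mset \<mu> \<subseteq> {1..K::nat} \<and> \<Sum>\<^sub># \<mu> = n}"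
  by (rule finite_subset [OF _ finite_Par_of_size [of n]]) (auto simp: Par_def)

lemma sum_mset_replicate: "\<Sum>\<^sub># (replicate_mset m i) = m * (i :: nat)"
  by (induction m) auto

lemma part_weight_add_replicate:
  assumes "k \<notin># \<nu>" "a k 0 = 1"
  shows "part_weight a (\<nu> + replicate_mset m k) = a k m * part_weight a \<nu>"
proof (cases "m = 0")
  case False
  then have "part_weight a (\<nu> + replicate_mset m k) =
      (\<Prod>i\<in>insert k (set_mset \<nu>). a i (count (\<nu> + replicate_mset m k) i))"
    by (simp add: part_weight_def)
  also have "\<dots> = a k m * (\<Prod>i\<in>set_mset \<nu>. a i (count (\<nu> + replicate_mset m k) i))"
    using assms(1) by (simp add: not_in_iff)
  also have "(\<Prod>i\<in>set_mset \<nu>. a i (count (\<nu> + replicate_mset m k) i)) = part_weight a \<nu>"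
    unfolding part_weight_def using assms(1) by (intro prod.cong) auto
  finally show ?thesis .
qed (simp add: assms(2))

lemma fps_nth_prod_euler_factor:
  assumes a0: "\<And>i. a i 0 = 1"
  shows "fps_nth (\<Prod>i=1..K. euler_factor a i) n =
    (\<Sum>\<mu> | set_mset \<mu> \<subseteq> {1..K} \<and> \<Sum>\<^sub># \<mu> = n. part_weight a \<mu>)"
proof (induction K arbitrary: n)
  case 0
  have "{\<mu>. set_mset \<mu> \<subseteq> {1..0::nat} \<and> \<Sum>\<^sub># \<mu> = n} = (if n = 0 then {{#}} else {})" by auto
  then show ?case by (simp add: part_weight_def)
next
  case (Suc K)
  let ?k = "Suc K"
  define R where "R K n = {\<mu>. set_mset \<mu> \<subseteq> {1..K} \<and> \<Sum>\<^sub># \<mu> = n}" for K n :: nat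
  have fin: "finite (R K n)" for K n unfolding R_def by (rule finite_parts_upto)
  have "fps_nth (\<Prod>i=1..?k. euler_factor a i) n =
      (\<Sum>j=0..n. fps_nth (euler_factor a ?k) j * fps_nth (\<Prod>i=1..K. euler_factor a i) (n - j))"
    by (simp add: fps_mult_nth mult.commute)
  also have "\<dots> = (\<Sum>j | j \<le> n \<and> ?k dvd j. a ?k (j div ?k) * (\<Sum>\<nu>\<in>R K (n - j). part_weight a \<nu>))"
    unfolding Suc.IH by (intro sum.mono_neutral_cong_right) (auto simp: euler_factor_def R_def)
  also have "\<dots> = (\<Sum>(j, \<nu>)\<in>(SIGMA j:{j. j \<le> n \<and> ?k dvd j}. R K (n - j)).
      a ?k (j div ?k) * part_weight a \<nu>)"
    unfolding sum_distrib_left by (rule sum.Sigma) (auto simp: fin)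
  \<comment> \<open>A partition is split into its parts equal to \<open>?k\<close> and the smaller
    ones. Here j is the total size of the former, so their number is
    \<open>j div ?k\<close>.\<close>
  also have "\<dots> = (\<Sum>\<mu>\<in>R ?k n. part_weight a \<mu>)"
  proof (rule sum.reindex_bij_witness
      [where i = "\<lambda>\<mu>. (?k * count \<mu> ?k, filter_mset (\<lambda>i. i \<noteq> ?k) \<mu>)"
         and j = "\<lambda>(j, \<nu>). \<nu> + replicate_mset (j div ?k) ?k"])
    fix x assume "x \<in> (SIGMA j:{j. j \<le> n \<and> ?k dvd j}. R K (n - j))"
    then obtain j \<nu> where x: "x = (j, \<nu>)" "j \<le> n" "?k dvd j" "set_mset \<nu> \<subseteq> {1..K}" "\<Sum>\<^sub># \<nu> = n - j"
      by (auto simp: R_def)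
    have k: "?k \<notin># \<nu>" using x(4) by auto
    have j: "?k * (j div ?k) = j" "j div ?k * ?k = j"
      using x(3) by (simp_all only: dvd_mult_div_cancel dvd_div_mult_self)
    have "filter_mset (\<lambda>i. i \<noteq> ?k) \<nu> = \<nu>"
      using k by (auto simp: filter_mset_eq_conv)
    then show "(case case x of (j, \<nu>) \<Rightarrow> \<nu> + replicate_mset (j div ?k) ?k of \<mu> \<Rightarrow>
        (?k * count \<mu> ?k, filter_mset (\<lambda>i. i \<noteq> ?k) \<mu>)) = x"
      using k j by (simp add: x(1) not_in_iff del: mult_Suc)
    show "(case x of (j, \<nu>) \<Rightarrow> \<nu> + replicate_mset (j div ?k) ?k) \<in> R ?k n"
      using x j by (auto simp: R_def sum_mset_replicate subset_iff in_replicate_mset simp del: mult_Suc mult_Suc_right)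
    show "part_weight a (case x of (j, \<nu>) \<Rightarrow> \<nu> + replicate_mset (j div ?k) ?k) =
        (case x of (j, \<nu>) \<Rightarrow> a ?k (j div ?k) * part_weight a \<nu>)"
      by (simp add: x(1) part_weight_add_replicate [OF k, of a, OF a0])
  next
    fix \<mu> assume "\<mu> \<in> R ?k n"
    then have \<mu>: "set_mset \<mu> \<subseteq> {1..?k}" "\<Sum>\<^sub># \<mu> = n" by (auto simp: R_def)
    let ?\<nu> = "filter_mset (\<lambda>i. i \<noteq> ?k) \<mu>"
    have split: "?\<nu> + replicate_mset (count \<mu> ?k) ?k = \<mu>"
      by (rule multiset_eqI) auto
    show "(case (?k * count \<mu> ?k, ?\<nu>) of (j, \<nu>) \<Rightarrow> \<nu> + replicate_mset (j div ?k) ?k) = \<mu>"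
      using split by (simp del: mult_Suc)
    have "n = \<Sum>\<^sub># ?\<nu> + count \<mu> ?k * ?k"
      using arg_cong [OF split, of sum_mset] \<mu>(2) by (simp only: sum_mset.union sum_mset_replicate)
    then have "?k * count \<mu> ?k \<le> n" "\<Sum>\<^sub># ?\<nu> = n - ?k * count \<mu> ?k"
      by (simp_all only: mult.commute)
    moreover have "set_mset ?\<nu> \<subseteq> {1..K}" using \<mu>(1) by force
    ultimately show "(?k * count \<mu> ?k, ?\<nu>) \<in> (SIGMA j:{j. j \<le> n \<and> ?k dvd j}. R K (n - j))"
      by (auto simp: R_def simp del: mult_Suc)
  qed
  finally show ?case by (simp add: R_def)
qed

text \<open>A partition of n has no part above n, so factors with larger index do not affect this
  coefficient. Statements about the infinite product thereby reduce to finite ones.\<close>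

lemma fps_nth_euler_series:
  assumes "\<And>i. a i 0 = 1" "n \<le> K"
  shows "fps_nth (euler_series a) n = fps_nth (\<Prod>i=1..K. euler_factor a i) n"
proof -
  have "i \<le> \<Sum>\<^sub># \<mu>" if "i \<in># \<mu>" for i and \<mu> :: "nat multiset"
    using that by (metis le_add1 multi_member_split sum_mset.add_mset)
  then have "{\<mu> \<in> Par. \<Sum>\<^sub># \<mu> = n} = {\<mu>. set_mset \<mu> \<subseteq> {1..K} \<and> \<Sum>\<^sub># \<mu> = n}"
    using assms(2) by (fastforce simp: Par_def Suc_le_eq intro: Nat.gr0I)
  then show ?thesis
    unfolding fps_nth_prod_euler_factor [of a, OF assms(1)] by (simp add: euler_series_def)
qed

lemma fps_nth_0_euler_series: "fps_nth (euler_series a) 0 = 1"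
proof -
  have "{\<mu> \<in> Par. \<Sum>\<^sub># \<mu> = 0} = {{#}}" by (auto simp: Par_def) (metis multiset_nonemptyE)
  then show ?thesis by (simp add: euler_series_def part_weight_def)
qed

text \<open>Convergence is coefficientwise, and the coefficient of t^n is constant from the nth
  partial product on. The index set of \<open>has_prod\<close> starts at 0, where
  \<open>f 0 = 1\<close> adds a neutral factor.\<close>

lemma has_prod_euler_series:
  assumes a0: "\<And>i. a i 0 = 1" and f0: "f 0 = 1" and f: "\<And>i. i \<ge> 1 \<Longrightarrow> f i = euler_factor a i"
  shows "f has_prod euler_series a"
proof -
  have "(\<lambda>n. \<Prod>i\<le>n. f i) \<longlonglongrightarrow> euler_series a"
  proof (rule tendsto_fpsI)
    fix n
    have "(\<Prod>i\<le>K. f i) = (\<Prod>i=1..K. euler_factor a i)" for K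
    proof -
      have "{..K} = insert 0 {1..K}" by auto
      then show ?thesis using f0 f by simp
    qed
    then show "\<forall>\<^sub>F K in sequentially. fps_nth (\<Prod>i\<le>K. f i) n = fps_nth (euler_series a) n"
      using fps_nth_euler_series [of a, OF a0] unfolding eventually_sequentially by metis
  qed
  \<comment> \<open>\<open>has_prod\<close> demands a nonzero limit; the constant coefficient is
    1.\<close>
  moreover have "euler_series a \<noteq> 0" using fps_nth_0_euler_series [of a] by auto
  ultimately show ?thesis by (simp add: has_prod_def raw_has_prod_def)
qed

text \<open>There are finitely many partitions of n. Once a finite partial sum contains those in
  \<open>A\<close>, its coefficient of t^n no longer changes.\<close>

lemma has_sum_euler_series:
  assumes A: "A \<subseteq> Par" and zero: "\<And>\<mu>. \<mu> \<in> Par - A \<Longrightarrow> part_weight a \<mu> = 0"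
    and f: "\<And>\<mu>. \<mu> \<in> A \<Longrightarrow> f \<mu> = fps_X ^ (\<Sum>\<^sub># \<mu>) * fps_const (part_weight a \<mu>)"
  shows "(f has_sum euler_series a) A"
  unfolding has_sum_def
proof (rule tendsto_fpsI)
  fix n
  define B where "B = {\<mu> \<in> A. \<Sum>\<^sub># \<mu> = n}"
  have B: "finite B" "B \<subseteq> A"
    using A finite_subset [OF _ finite_Par_of_size [of n], of B] by (auto simp: B_def)
  have "fps_nth (sum f F) n = fps_nth (euler_series a) n"
    if F: "finite F" "B \<subseteq> F" "F \<subseteq> A" for F
  proof -
    have "fps_nth (sum f F) n = (\<Sum>\<mu>\<in>F. if \<Sum>\<^sub># \<mu> = n then part_weight a \<mu> else 0)"
      unfolding fps_sum_nth using F(3)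
      by (intro sum.cong refl) (auto simp: f fps_X_power_mult_nth)
    also have "\<dots> = (\<Sum>\<mu>\<in>B. part_weight a \<mu>)"
      using F by (intro sum.mono_neutral_cong_right) (auto simp: B_def)
    also have "\<dots> = (\<Sum>\<mu> | \<mu> \<in> Par \<and> \<Sum>\<^sub># \<mu> = n. part_weight a \<mu>)"
      using finite_Par_of_size [of n] A zero
      by (intro sum.mono_neutral_left) (auto simp: B_def)
    finally show ?thesis by (simp add: euler_series_def)
  qed
  then show "\<forall>\<^sub>F F in finite_subsets_at_top A. fps_nth (sum f F) n = fps_nth (euler_series a) n"
    using B by (auto simp: eventually_finite_subsets_at_top)
qed

text \<open>
  If \<open>m a\<^sub>i(m) = \<Sum>\<^sub>k g\<^sub>i(k) a\<^sub>i(m - k)\<close>, then \<open>\<Sum>\<^sub>k i g\<^sub>i(k) t\<^bsup>i k\<^esup>\<close> is \<open>t\<close> times the logarithmic derivative of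
  the \<open>i\<close>-th factor.
\<close>

definition log_deriv :: "(nat \<Rightarrow> nat \<Rightarrow> 'r) \<Rightarrow> nat \<Rightarrow> 'r::comm_ring_1 fps" where
  "log_deriv g i = Abs_fps (\<lambda>n. if i dvd n \<and> n > 0 then of_nat i * g i (n div i) else 0)"

text \<open>At \<open>n = i * m\<close> the claim is i times the assumed recursion. If i does not
  divide n, it cannot divide both j and n - j, so the convolution vanishes as well.\<close>

lemma log_deriv_euler_factor:
  assumes i: "i \<ge> 1" and newton: "\<And>m. m \<ge> 1 \<Longrightarrow> of_nat m * a i m = (\<Sum>k=1..m. g i k * a i (m - k))"
  shows "fps_X * fps_deriv (euler_factor a i) = log_deriv g i * euler_factor a i"
proof (rule fps_ext)
  fix n
  have "fps_nth (log_deriv g i * euler_factor a i) n =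
      (\<Sum>j=0..n. fps_nth (log_deriv g i) j * fps_nth (euler_factor a i) (n - j))"
    by (simp add: fps_mult_nth)
  also have "\<dots> = (if i dvd n then of_nat n * a i (n div i) else 0)"
  proof (cases "i dvd n")
    case False
    then have "fps_nth (log_deriv g i) j * fps_nth (euler_factor a i) (n - j) = 0" if "j \<le> n" for j
      using that by (auto simp: log_deriv_def euler_factor_def) (metis dvd_diffD)
    then show ?thesis using False by simp
  next
    case True
    then obtain m where m: "n = i * m" by blast
    have "(\<Sum>j=0..n. fps_nth (log_deriv g i) j * fps_nth (euler_factor a i) (n - j)) =
        (\<Sum>j\<in>(*) i ` {1..m}. fps_nth (log_deriv g i) j * fps_nth (euler_factor a i) (n - j))"
      using i m by (intro sum.mono_neutral_right) (auto simp: log_deriv_def dvd_def)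
    also have "\<dots> = (\<Sum>k=1..m. of_nat i * (g i k * a i (m - k)))"
    proof (subst sum.reindex)
      show "inj_on ((*) i) {1..m}" using i by (auto simp: inj_on_def)
      show "sum ((\<lambda>j. fps_nth (log_deriv g i) j * fps_nth (euler_factor a i) (n - j)) \<circ> (*) i) {1..m} =
          (\<Sum>k=1..m. of_nat i * (g i k * a i (m - k)))"
        using i m by (intro sum.cong refl)
          (auto simp: log_deriv_def euler_factor_def mult.assoc simp flip: diff_mult_distrib2)
    qed
    also have "\<dots> = of_nat i * (of_nat m * a i m)"
      using newton [of m] by (cases "m = 0") (simp_all add: sum_distrib_left)
    finally show ?thesis using i m by (simp add: mult.assoc)
  qed
  also have "\<dots> = fps_nth (fps_X * fps_deriv (euler_factor a i)) n"
    by (cases n) (simp_all add: euler_factor_def)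
  finally show "fps_nth (fps_X * fps_deriv (euler_factor a i)) n =
    fps_nth (log_deriv g i * euler_factor a i) n" ..
qed

text \<open>The Leibniz rule. The logarithmic derivative appears as a factor \<open>G i\<close>
  instead of a quotient, which makes sense over any commutative ring.\<close>

lemma log_deriv_prod:
  fixes F G :: "nat \<Rightarrow> 'r::comm_ring_1 fps"
  assumes "finite I" "\<And>i. i \<in> I \<Longrightarrow> fps_X * fps_deriv (F i) = G i * F i"
  shows "fps_X * fps_deriv (prod F I) = sum G I * prod F I"
  using assms
proof (induction I rule: finite_induct)
  case (insert i I)
  have "fps_X * fps_deriv (prod F (insert i I)) =
      (fps_X * fps_deriv (F i)) * prod F I + F i * (fps_X * fps_deriv (prod F I))"
    using insert.hyps by (simp add: algebra_simps)
  also have "\<dots> = (G i * F i) * prod F I + F i * (sum G I * prod F I)"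
    using insert by simp
  finally show ?case using insert.hyps by (simp add: algebra_simps)
qed simp

lemma sum_log_deriv_nth:
  assumes "1 \<le> j" "j \<le> K"
  shows "fps_nth (\<Sum>i=1..K. log_deriv g i) j = (\<Sum>i | i dvd j. of_nat i * g i (j div i))"
proof -
  have "1 \<le> i \<and> i \<le> K" if "i dvd j" for i
    using that assms dvd_imp_le [of i j] dvd_pos_nat [of j i] by auto
  then show ?thesis
    unfolding fps_sum_nth using assms
    by (intro sum.mono_neutral_cong_right) (auto simp: log_deriv_def)
qed

text \<open>The equation t P' = L P with constant coefficient 1 has one solution, because n cancels
  in the recursion for the nth coefficient. Only the sum L of all logarithmic derivatives enters, so
  the individual factors of the two products may differ.\<close>

lemma euler_series_eqI:
  fixes a a' g g' :: "nat \<Rightarrow> nat \<Rightarrow> symf"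
  assumes "\<And>i. a i 0 = 1" "\<And>i. a' i 0 = 1"
    and "\<And>i m. i \<ge> 1 \<Longrightarrow> m \<ge> 1 \<Longrightarrow> of_nat m * a i m = (\<Sum>k=1..m. g i k * a i (m - k))"
    and "\<And>i m. i \<ge> 1 \<Longrightarrow> m \<ge> 1 \<Longrightarrow> of_nat m * a' i m = (\<Sum>k=1..m. g' i k * a' i (m - k))"
    and log: "\<And>n. n \<ge> 1 \<Longrightarrow>
      (\<Sum>i | i dvd n. of_nat i * g i (n div i)) = (\<Sum>i | i dvd n. of_nat i * g' i (n div i))"
  shows "euler_series a = euler_series a'"
proof (rule fps_ext)
  \<comment> \<open>The index of the coefficient to be compared is also the truncation bound of both
    products.\<close>
  fix K
  define P where "P a = (\<Prod>i=1..K. euler_factor a i)" for a :: "nat \<Rightarrow> nat \<Rightarrow> symf"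
  define L where "L g = (\<Sum>i=1..K. log_deriv g i)" for g :: "nat \<Rightarrow> nat \<Rightarrow> symf"
  have deriv: "of_nat n * fps_nth (P a) n = (\<Sum>j=1..n. fps_nth (L g) j * fps_nth (P a) (n - j))"
    if newton: "\<And>i m. i \<ge> 1 \<Longrightarrow> m \<ge> 1 \<Longrightarrow> of_nat m * a i m = (\<Sum>k=1..m. g i k * a i (m - k))"
    for a g :: "nat \<Rightarrow> nat \<Rightarrow> symf" and n
  proof -
    have "of_nat n * fps_nth (P a) n = fps_nth (fps_X * fps_deriv (P a)) n"
      by (cases n) simp_all
    also have "fps_X * fps_deriv (P a) = L g * P a"
      unfolding P_def L_def using newton
      by (intro log_deriv_prod log_deriv_euler_factor) auto
    also have "fps_nth (L g * P a) n = (\<Sum>j=0..n. fps_nth (L g) j * fps_nth (P a) (n - j))"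
      by (simp add: fps_mult_nth)
    also have "\<dots> = (\<Sum>j=1..n. fps_nth (L g) j * fps_nth (P a) (n - j))"
      by (intro sum.mono_neutral_right) (auto simp: L_def log_deriv_def fps_sum_nth not_less_eq_eq)
    finally show ?thesis .
  qed
  have "fps_nth (P a) n = fps_nth (P a') n" if "n \<le> K" for n
    using that
  proof (induction n rule: less_induct)
    case (less n)
    show ?case
    proof (cases "n = 0")
      case True
      then show ?thesis
        using fps_nth_euler_series [of a 0 K] fps_nth_euler_series [of a' 0 K] assms(1,2)
        by (simp add: P_def fps_nth_0_euler_series)
    next
      case False
      have "of_nat n * fps_nth (P a) n = (\<Sum>j=1..n. fps_nth (L g) j * fps_nth (P a) (n - j))"
        using deriv [of a g n, OF assms(3)] .
      also have "\<dots> = (\<Sum>j=1..n. fps_nth (L g') j * fps_nth (P a') (n - j))"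
      proof (rule sum.cong [OF refl])
        fix j assume j: "j \<in> {1..n}"
        then have "fps_nth (L g) j = fps_nth (L g') j"
          using less.prems log [of j] by (simp add: L_def sum_log_deriv_nth [of j K] del: fps_sum_nth One_nat_def)
        moreover have "fps_nth (P a) (n - j) = fps_nth (P a') (n - j)"
          using j less by auto
        ultimately show "fps_nth (L g) j * fps_nth (P a) (n - j) = fps_nth (L g') j * fps_nth (P a') (n - j)"
          by simp
      qed
      also have "\<dots> = of_nat n * fps_nth (P a') n"
        using deriv [of a' g' n, OF assms(4)] by simp
      finally show ?thesis using of_nat_symf_cancel False by blast
    qed
  qed
  then show "fps_nth (euler_series a) K = fps_nth (euler_series a') K"
    using fps_nth_euler_series [of a K K] fps_nth_euler_series [of a' K K] assms(1,2)
    by (simp add: P_def)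
qed

section \<open>The character of an induced module\<close>

lemma sum_fun_apply: "sum f A x = (\<Sum>a\<in>A. f a x :: 'a::comm_monoid_add)"
  by (induction A rule: infinite_finite_induct) auto

text \<open>
  Any expansion \<open>T f = \<Sum>\<^sub>g f(g) \<phi>\<^sub>g\<close> over the points \<open>g\<close>, with \<open>\<phi>\<^sub>g \<in> W\<close>, gives the trace of \<open>T\<close> on \<open>W\<close> as
  \<open>\<Sum>\<^sub>g \<phi>\<^sub>g(g)\<close>, whatever basis of \<open>W\<close> is used.
\<close>

lemma trace_on_eq:
  fixes W :: "('a \<Rightarrow> complex) set"
  assumes X: "finite X" and W: "cfun.subspace W" and supp: "\<And>f x. f \<in> W \<Longrightarrow> x \<notin> X \<Longrightarrow> f x = 0"
    and phi: "\<And>g. g \<in> X \<Longrightarrow> \<phi> g \<in> W" and T: "\<And>f. f \<in> W \<Longrightarrow> T f = (\<lambda>x. \<Sum>g\<in>X. f g * \<phi> g x)"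
  shows "trace_on W T = (\<Sum>g\<in>X. \<phi> g g)"
proof -
  define B where "B = (SOME B. cfun.independent B \<and> cfun.span B = W)"
  obtain B0 where "B0 \<subseteq> W" "cfun.independent B0" "W \<subseteq> cfun.span B0"
    using cfun.maximal_independent_subset .
  then have "\<exists>B. cfun.independent B \<and> cfun.span B = W"
    using cfun.span_subspace W by blast
  then have B: "cfun.independent B" "cfun.span B = W"
    unfolding B_def by (metis (mono_tags, lifting) someI_ex)+
  \<comment> \<open>The point functions on \<open>X\<close> span a space containing
    \<open>W\<close>, which forces the basis \<open>B\<close> to be finite.\<close>
  define \<delta> :: "'a \<Rightarrow> 'a \<Rightarrow> complex" where "\<delta> y = (\<lambda>x. if x = y then 1 else 0)" for y
  have "W \<subseteq> cfun.span (\<delta> ` X)"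
  proof
    fix f assume f: "f \<in> W"
    have "f = (\<Sum>y\<in>X. (\<lambda>x. f y * \<delta> y x))"
      using X supp [OF f] by (auto simp: fun_eq_iff sum_fun_apply \<delta>_def if_distrib sum.delta' cong: if_cong)
    also have "\<dots> \<in> cfun.span (\<delta> ` X)"
      by (intro cfun.span_sum cfun.span_scale cfun.span_base) auto
    finally show "f \<in> cfun.span (\<delta> ` X)" .
  qed
  then have "finite B"
    using cfun.independent_span_bound [of "\<delta> ` X" B] B X cfun.span_superset [of B] by auto
  let ?r = "\<lambda>v b. cfun.representation B v b"
  have span: "\<phi> g \<in> cfun.span B" if "g \<in> X" for g using phi that B(2) by simp
  have "trace_on W T = (\<Sum>b\<in>B. ?r (T b) b)"
    by (simp add: trace_on_def Let_def B_def)
  also have "\<dots> = (\<Sum>b\<in>B. \<Sum>g\<in>X. b g * ?r (\<phi> g) b)"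
  proof (rule sum.cong [OF refl])
    fix b assume b: "b \<in> B"
    then have "T b = (\<Sum>g\<in>X. (\<lambda>x. b g * \<phi> g x))"
      using T [of b] B(2) cfun.span_superset [of B] by (auto simp: fun_eq_iff sum_fun_apply)
    then show "?r (T b) b = (\<Sum>g\<in>X. b g * ?r (\<phi> g) b)"
      using span by (simp add: cfun.representation_sum [OF B(1)] cfun.span_scale
          cfun.representation_scale [OF B(1)])
  qed
  also have "\<dots> = (\<Sum>g\<in>X. \<Sum>b\<in>B. b g * ?r (\<phi> g) b)"
    by (rule sum.swap)
  \<comment> \<open>After the exchange, the inner sum is the basis expansion of
    \<open>\<phi> g\<close>, evaluated at the point g.\<close>
  also have "\<dots> = (\<Sum>g\<in>X. \<phi> g g)"
  proof (rule sum.cong [OF refl])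
    fix g assume "g \<in> X"
    then have "(\<Sum>b\<in>B. (\<lambda>x. ?r (\<phi> g) b * b x)) = \<phi> g"
      using cfun.sum_representation_eq [OF B(1) span \<open>finite B\<close> subset_refl] by simp
    then have "(\<Sum>b\<in>B. (\<lambda>x. ?r (\<phi> g) b * b x)) g = \<phi> g g" by simp
    then show "(\<Sum>b\<in>B. b g * ?r (\<phi> g) b) = \<phi> g g"
      by (simp add: sum_fun_apply mult.commute)
  qed
  finally show ?thesis .
qed

text \<open>Frobenius's formula for an induced character:
  \<open>h \<otimes> g = g \<otimes> \<sigma>\<close> says that h is the conjugate of \<sigma> by g,
  and averaging over the whole group replaces a choice of coset representatives.\<close>

lemma trace_on_induced_module:
  fixes G (structure)
  assumes "group G" "finite (carrier G)" and H: "subgroup H G"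
    and mult: "\<And>h k. h \<in> H \<Longrightarrow> k \<in> H \<Longrightarrow> \<psi> (h \<otimes> k) = \<psi> h * \<psi> k"
    and \<sigma>: "\<sigma> \<in> carrier G"
  shows "trace_on (induced_module G H \<psi>) (induced_action G \<sigma>) =
    (\<Sum>g\<in>carrier G. \<Sum>h\<in>H. if h \<otimes> g = g \<otimes> \<sigma> then \<psi> h else 0) / of_nat (card H)"
proof -
  interpret group G by fact
  interpret H: subgroup H G by fact
  have finH: "finite H" using assms(2) H.subset finite_subset by blast
  then have cardH: "card H > 0" using H.one_closed by (metis card_gt_0_iff empty_iff)
  \<comment> \<open>For every h in \<open>H\<close>, \<open>f (x \<otimes> \<sigma>) = \<psi> h * f
    (inv h \<otimes> (x \<otimes> \<sigma>))\<close>. Averaging over h and collecting the terms with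
    the same argument g of f gives this kernel; the average also places it in the module.\<close>
  define \<phi> where "\<phi> g x = (if x \<in> carrier G
    then (\<Sum>h\<in>H. if h \<otimes> g = x \<otimes> \<sigma> then \<psi> h else 0) / of_nat (card H) else 0)" for g x
  have "trace_on (induced_module G H \<psi>) (induced_action G \<sigma>) = (\<Sum>g\<in>carrier G. \<phi> g g)"
  proof (rule trace_on_eq [where \<phi> = \<phi>, OF assms(2)])
    show "cfun.subspace (induced_module G H \<psi>)"
      by (rule cfun.subspaceI) (auto simp: induced_module_def algebra_simps)
    show "f x = 0" if "f \<in> induced_module G H \<psi>" "x \<notin> carrier G" for f x
      using that by (auto simp: induced_module_def)
    show "\<phi> g \<in> induced_module G H \<psi>" if g: "g \<in> carrier G" for g
    proof -
      have "\<phi> g (k \<otimes> x) = \<psi> k * \<phi> g x" if k: "k \<in> H" and x: "x \<in> carrier G" for k x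
      proof -
        have kG: "k \<in> carrier G" using k H.subset by blast
        have "(\<Sum>h\<in>H. if h \<otimes> g = k \<otimes> x \<otimes> \<sigma> then \<psi> h else 0) =
            (\<Sum>h\<in>H. if h \<otimes> g = x \<otimes> \<sigma> then \<psi> k * \<psi> h else 0)"
        proof (rule sum.reindex_bij_witness [where i = "\<lambda>h. k \<otimes> h" and j = "\<lambda>h. inv k \<otimes> h"])
          fix h assume h: "h \<in> H"
          then have hG: "h \<in> carrier G" using H.subset by blast
          show "inv k \<otimes> (k \<otimes> h) = h" "k \<otimes> (inv k \<otimes> h) = h"
            using kG hG by (simp_all add: m_assoc [symmetric])
          show "k \<otimes> h \<in> H" "inv k \<otimes> h \<in> H" using k h by auto
          have "inv k \<otimes> h \<otimes> g = x \<otimes> \<sigma> \<longleftrightarrow> h \<otimes> g = k \<otimes> x \<otimes> \<sigma>"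
            using kG hG g x \<sigma> by (metis inv_solve_left m_assoc m_closed inv_closed)
          moreover have "\<psi> k * \<psi> (inv k \<otimes> h) = \<psi> h"
            using mult [of k "inv k \<otimes> h"] k h kG hG by (simp add: m_assoc [symmetric])
          ultimately show "(if inv k \<otimes> h \<otimes> g = x \<otimes> \<sigma> then \<psi> k * \<psi> (inv k \<otimes> h) else 0) =
              (if h \<otimes> g = k \<otimes> x \<otimes> \<sigma> then \<psi> h else 0)" by simp
        qed
        also have "\<dots> = \<psi> k * (\<Sum>h\<in>H. if h \<otimes> g = x \<otimes> \<sigma> then \<psi> h else 0)"
          unfolding sum_distrib_left by (intro sum.cong) auto
        finally show ?thesis using kG x by (simp add: \<phi>_def)
      qed
      then show ?thesis by (auto simp: induced_module_def \<phi>_def)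
    qed
    show "induced_action G \<sigma> f = (\<lambda>x. \<Sum>g\<in>carrier G. f g * \<phi> g x)"
      if f: "f \<in> induced_module G H \<psi>" for f
    proof
      fix x
      show "induced_action G \<sigma> f x = (\<Sum>g\<in>carrier G. f g * \<phi> g x)"
      proof (cases "x \<in> carrier G")
        case x: True
        have "(\<Sum>g\<in>carrier G. f g * (\<Sum>h\<in>H. if h \<otimes> g = x \<otimes> \<sigma> then \<psi> h else 0)) =
            (\<Sum>h\<in>H. \<Sum>g\<in>carrier G. f g * (if h \<otimes> g = x \<otimes> \<sigma> then \<psi> h else 0))"
          unfolding sum_distrib_left by (rule sum.swap)
        also have "\<dots> = (\<Sum>h\<in>H. f (x \<otimes> \<sigma>))"
        proof (rule sum.cong [OF refl])
          fix h assume h: "h \<in> H"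
          then have hG: "h \<in> carrier G" using H.subset by blast
          have "h \<otimes> g = x \<otimes> \<sigma> \<longleftrightarrow> g = inv h \<otimes> (x \<otimes> \<sigma>)" if "g \<in> carrier G" for g
            using that hG x \<sigma> by (metis inv_solve_left m_closed)
          then have "(\<Sum>g\<in>carrier G. f g * (if h \<otimes> g = x \<otimes> \<sigma> then \<psi> h else 0)) =
              (\<Sum>g\<in>carrier G. if g = inv h \<otimes> (x \<otimes> \<sigma>) then \<psi> h * f g else 0)"
            by (intro sum.cong) auto
          also have "\<dots> = \<psi> h * f (inv h \<otimes> (x \<otimes> \<sigma>))"
            using assms(2) hG x \<sigma> by simp
          also have "\<dots> = f (h \<otimes> (inv h \<otimes> (x \<otimes> \<sigma>)))"
            using f h hG x \<sigma> by (simp add: induced_module_def)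
          also have "h \<otimes> (inv h \<otimes> (x \<otimes> \<sigma>)) = x \<otimes> \<sigma>"
            using hG x \<sigma> by (metis inv_solve_left m_closed inv_closed)
          finally show "(\<Sum>g\<in>carrier G. f g * (if h \<otimes> g = x \<otimes> \<sigma> then \<psi> h else 0)) = f (x \<otimes> \<sigma>)" .
        qed
        finally show ?thesis
          using x cardH by (simp add: induced_action_def \<phi>_def flip: sum_divide_distrib)
      qed (simp add: induced_action_def \<phi>_def)
    qed
  qed
  then show ?thesis by (simp add: \<phi>_def sum_divide_distrib)
qed

text \<open>The injection g carries orbits of the conjugate onto orbits of \<tau>, preserving their
  cardinalities.\<close>

lemma cycle_type_conj:
  assumes \<tau>: "\<tau> permutes {1..n}" and g: "g permutes {1..n}"
  shows "cycle_type n (inv' g \<circ> \<tau> \<circ> g) = cycle_type n \<tau>"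
proof -
  define \<sigma> where "\<sigma> = inv' g \<circ> \<tau> \<circ> g"
  have inj: "inj g" using g permutes_inj by blast
  have perm: "permutation \<sigma>"
    unfolding \<sigma>_def using \<tau> g
    by (meson finite_atLeastAtMost permutation_compose permutation_inverse permutation_permutes)
  have eq: "\<tau> (g x) = g (\<sigma> x)" for x
    using permutes_inverses(1) [OF g] by (simp add: \<sigma>_def)
  have orb: "g ` orbit \<sigma> x = orbit \<tau> (g x)" for x
    by (rule orbit_inverse [OF permutation_self_in_orbit [OF perm]]) (rule eq)
  have "orbit \<tau> ` {1..n} = orbit \<tau> ` g ` {1..n}"
    by (simp only: permutes_image [OF g])
  also have "\<dots> = (`) g ` orbit \<sigma> ` {1..n}"
    unfolding image_image orb ..
  finally have "cycle_type n \<tau> = image_mset card (mset_set ((`) g ` orbit \<sigma> ` {1..n}))"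
    by (simp add: cycle_type_def)
  also have "mset_set ((`) g ` orbit \<sigma> ` {1..n}) = image_mset ((`) g) (mset_set (orbit \<sigma> ` {1..n}))"
    by (rule image_mset_mset_set [symmetric]) (simp add: inj_on_def inj_image_eq_iff [OF inj])
  also have "image_mset card \<dots> = cycle_type n \<sigma>"
    using inj
    by (simp add: cycle_type_def multiset.map_comp o_def card_image inj_on_subset [OF inj])
  finally show ?thesis by (simp add: \<sigma>_def)
qed

text \<open>For given g and h only the conjugate of h by g contributes, and it has the cycle type of
  h. The sum over g is therefore constant and its n! terms cancel the normalization.\<close>

lemma frobenius_ch_induced_module:
  assumes H: "subgroup H (sym_group n)"
    and mult: "\<And>h k. h \<in> H \<Longrightarrow> k \<in> H \<Longrightarrow> \<psi> (h \<circ> k) = \<psi> h * \<psi> k"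
  shows "frobenius_ch n (induced_module (sym_group n) H \<psi>) (induced_action (sym_group n)) =
    mconst (1 / of_nat (card H)) * (\<Sum>h\<in>H. mconst (\<psi> h) * p_part (cycle_type n h))"
proof -
  define C where "C = carrier (sym_group n)"
  define F where "F \<sigma> = p_part (cycle_type n \<sigma>)" for \<sigma>
  have C: "C = {\<sigma>. \<sigma> permutes {1..n}}" by (simp add: C_def sym_group_def)
  have finC: "finite C" unfolding C by (rule finite_permutations) simp
  have HC: "H \<subseteq> C" using H by (simp add: C_def subgroup.subset)
  have trace: "trace_on (induced_module (sym_group n) H \<psi>) (induced_action (sym_group n) \<sigma>) =
      1 / of_nat (card H) * (\<Sum>g\<in>C. \<Sum>h\<in>H. if h \<circ> g = g \<circ> \<sigma> then \<psi> h else 0)" if "\<sigma> \<in> C" for \<sigma>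
    using trace_on_induced_module [OF sym_group_is_group _ H, of \<psi> \<sigma>] mult that finC
    by (simp add: sym_group_mult C_def)
  have inner: "(\<Sum>\<sigma>\<in>C. (if h \<circ> g = g \<circ> \<sigma> then mconst (\<psi> h) else 0) * F \<sigma>) = mconst (\<psi> h) * F h"
    if g: "g \<in> C" and h: "h \<in> H" for g h
  proof -
    have gp: "g permutes {1..n}" and hp: "h permutes {1..n}" using g h HC by (auto simp: C)
    have "h \<circ> g = g \<circ> \<sigma> \<longleftrightarrow> \<sigma> = inv' g \<circ> h \<circ> g" for \<sigma>
      using permutes_inv_o [OF gp] by (metis comp_assoc comp_id fun.map_id id_comp)
    then have "(\<Sum>\<sigma>\<in>C. (if h \<circ> g = g \<circ> \<sigma> then mconst (\<psi> h) else 0) * F \<sigma>) =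
        (\<Sum>\<sigma>\<in>C. if \<sigma> = inv' g \<circ> h \<circ> g then mconst (\<psi> h) * F \<sigma> else 0)"
      by (intro sum.cong) auto
    also have "\<dots> = mconst (\<psi> h) * F (inv' g \<circ> h \<circ> g)"
      using finC gp hp by (simp add: C permutes_compose permutes_inv)
    finally show ?thesis using cycle_type_conj [OF hp gp] by (simp add: F_def)
  qed
  have "(\<Sum>\<sigma>\<in>C. mconst (trace_on (induced_module (sym_group n) H \<psi>) (induced_action (sym_group n) \<sigma>)) * F \<sigma>) =
      (\<Sum>\<sigma>\<in>C. mconst (1 / of_nat (card H)) *
        (\<Sum>g\<in>C. \<Sum>h\<in>H. (if h \<circ> g = g \<circ> \<sigma> then mconst (\<psi> h) else 0) * F \<sigma>))"
  proof (rule sum.cong [OF refl])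
    fix \<sigma> assume "\<sigma> \<in> C"
    have "mconst (if P then x else 0) = (if P then mconst x else 0)" for P and x :: complex by simp
    then show "mconst (trace_on (induced_module (sym_group n) H \<psi>) (induced_action (sym_group n) \<sigma>)) * F \<sigma> =
        mconst (1 / of_nat (card H)) *
        (\<Sum>g\<in>C. \<Sum>h\<in>H. (if h \<circ> g = g \<circ> \<sigma> then mconst (\<psi> h) else 0) * F \<sigma>)"
      unfolding trace [OF \<open>\<sigma> \<in> C\<close>] mconst_mult mconst_sum
      by (simp add: sum_distrib_right mult.assoc)
  qed
  also have "\<dots> = mconst (1 / of_nat (card H)) *
      (\<Sum>\<sigma>\<in>C. \<Sum>g\<in>C. \<Sum>h\<in>H. (if h \<circ> g = g \<circ> \<sigma> then mconst (\<psi> h) else 0) * F \<sigma>)"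
    by (rule sum_distrib_left [symmetric])
  also have "(\<Sum>\<sigma>\<in>C. \<Sum>g\<in>C. \<Sum>h\<in>H. (if h \<circ> g = g \<circ> \<sigma> then mconst (\<psi> h) else 0) * F \<sigma>) =
      (\<Sum>g\<in>C. \<Sum>\<sigma>\<in>C. \<Sum>h\<in>H. (if h \<circ> g = g \<circ> \<sigma> then mconst (\<psi> h) else 0) * F \<sigma>)"
    by (rule sum.swap)
  also have "\<dots> = (\<Sum>g\<in>C. \<Sum>h\<in>H. \<Sum>\<sigma>\<in>C. (if h \<circ> g = g \<circ> \<sigma> then mconst (\<psi> h) else 0) * F \<sigma>)"
    by (intro sum.cong refl sum.swap)
  also have "\<dots> = (\<Sum>g\<in>C. \<Sum>h\<in>H. mconst (\<psi> h) * F h)"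
    by (intro sum.cong refl inner)
  also have "\<dots> = of_nat (fact n) * (\<Sum>h\<in>H. mconst (\<psi> h) * F h)"
    using card_permutations [of "{1..n}" n] by (simp add: C)
  finally have "frobenius_ch n (induced_module (sym_group n) H \<psi>) (induced_action (sym_group n)) =
      mconst (1 / of_nat (fact n)) * (of_nat (fact n) *
        (mconst (1 / of_nat (card H)) * (\<Sum>h\<in>H. mconst (\<psi> h) * F h)))"
    by (simp add: frobenius_ch_def C_def F_def mult.left_commute)
  then show ?thesis
    by (simp add: mconst_inverse_cancel F_def del: of_nat_fact)
qed

section \<open>The cyclic group generated by an \<open>n\<close>-cycle\<close>

lemma n_cycle_funpow_apply:
  assumes "x \<in> {1..n}"
  shows "(n_cycle n ^^ k) x = (x - 1 + k) mod n + 1"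
proof -
  let ?xs = "[1..<n + 1]"
  have x: "x - 1 < n" "?xs ! (x - 1) = x" using assms by (auto simp del: upt_Suc)
  have "map (n_cycle n ^^ k) ?xs = rotate k ?xs"
    unfolding n_cycle_def by (rule cyclic_rotation) simp
  then have "(n_cycle n ^^ k) (?xs ! (x - 1)) = rotate k ?xs ! (x - 1)"
    using x(1) by (metis add_diff_cancel_right' length_upt nth_map)
  also have "\<dots> = ?xs ! ((k + (x - 1)) mod n)"
    using x(1) by (simp add: nth_rotate del: upt_Suc)
  also have "\<dots> = 1 + (k + (x - 1)) mod n"
    using x(1) by (subst nth_upt) auto
  finally show ?thesis using x(2) by (simp add: add.commute del: upt_Suc)
qed

lemma n_cycle_permutes: "n_cycle n permutes {1..n}"
proof -
  have "set [1..<n + 1] = {1..n}" by auto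
  then show ?thesis using cycle_permutes [of "[1..<n + 1]"] by (metis n_cycle_def)
qed

lemma n_cycle_funpow_permutes: "n_cycle n ^^ k permutes {1..n}"
  by (rule permutes_funpow [OF n_cycle_permutes])

lemma n_cycle_funpow_eq_iff:
  assumes "n \<ge> 1"
  shows "n_cycle n ^^ k = n_cycle n ^^ l \<longleftrightarrow> k mod n = l mod n"
proof
  assume "n_cycle n ^^ k = n_cycle n ^^ l"
  then have "(n_cycle n ^^ k) 1 = (n_cycle n ^^ l) 1" by simp
  then show "k mod n = l mod n" using assms by (simp add: n_cycle_funpow_apply)
next
  assume eq: "k mod n = l mod n"
  show "n_cycle n ^^ k = n_cycle n ^^ l"
  proof
    fix x
    show "(n_cycle n ^^ k) x = (n_cycle n ^^ l) x"
    proof (cases "x \<in> {1..n}")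
      case True
      then show ?thesis
        unfolding n_cycle_funpow_apply [OF True] using mod_add_cong [OF refl eq, of "x - 1"] by simp
    next
      case False
      then show ?thesis
        using n_cycle_funpow_permutes [of k n] n_cycle_funpow_permutes [of l n]
        by (simp add: permutes_not_in)
    qed
  qed
qed

lemma cyclic_subgroup_subgroup: "subgroup (cyclic_subgroup n) (sym_group n)"
  unfolding cyclic_subgroup_def
  by (rule group.generate_is_subgroup [OF sym_group_is_group])
     (use n_cycle_permutes in \<open>auto simp: sym_group_carrier\<close>)

lemma cyclic_subgroup_eq:
  assumes "n \<ge> 1"
  shows "cyclic_subgroup n = (\<lambda>k. n_cycle n ^^ k) ` {..<n}"
proof -
  have "\<exists>k. \<tau> = n_cycle n ^^ k" if "\<tau> \<in> cyclic_subgroup n" for \<tau>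
    using that unfolding cyclic_subgroup_def
  proof (induction rule: generate.induct)
    case one
    then show ?case by (auto simp: sym_group_one intro: exI [of _ 0])
  next
    case (incl h)
    then show ?case by (auto intro: exI [of _ 1])
  next
    case (inv h)
    have "n_cycle n \<circ> n_cycle n ^^ (n - 1) = n_cycle n ^^ n"
      using assms by (metis Suc_diff_1 Suc_le_eq One_nat_def funpow.simps(2))
    also have "\<dots> = id" using n_cycle_funpow_eq_iff [OF assms, of n 0] by simp
    finally have "inv_into UNIV (n_cycle n) = n_cycle n ^^ (n - 1)"
      using n_cycle_permutes [of n] by (metis comp_assoc comp_id id_comp permutes_inv_o(2))
    then show ?case
      using inv n_cycle_permutes [of n] by (auto simp: sym_group_inv_equality sym_group_carrier)
  next
    case (eng h1 h2)
    then obtain k l where "h1 = n_cycle n ^^ k" "h2 = n_cycle n ^^ l" by blast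
    then show ?case by (auto simp: sym_group_mult simp flip: funpow_add)
  qed
  moreover have "n_cycle n ^^ k \<in> (\<lambda>k. n_cycle n ^^ k) ` {..<n}" for k
    by (rule image_eqI [of _ _ "k mod n"]) (use n_cycle_funpow_eq_iff [OF assms] assms in auto)
  ultimately have "cyclic_subgroup n \<subseteq> (\<lambda>k. n_cycle n ^^ k) ` {..<n}"
    by blast
  moreover have "n_cycle n ^^ k \<in> cyclic_subgroup n" for k
  proof (induction k)
    case 0
    then show ?case
      using subgroup.one_closed [OF cyclic_subgroup_subgroup] by (simp add: sym_group_one id_def)
  next
    case (Suc k)
    have "n_cycle n \<in> cyclic_subgroup n"
      by (auto simp: cyclic_subgroup_def intro: generate.incl)
    then show ?case
      using subgroup.m_closed [OF cyclic_subgroup_subgroup _ Suc.IH, of "n_cycle n"]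
      by (simp only: sym_group_mult funpow.simps)
  qed
  ultimately show ?thesis by blast
qed

lemma inj_on_n_cycle_funpow: "n \<ge> 1 \<Longrightarrow> inj_on (\<lambda>k. n_cycle n ^^ k) {..<n}"
  by (auto simp: inj_on_def n_cycle_funpow_eq_iff)

text \<open>The kth power is translation by k on residues modulo n. An orbit closes at the least
  positive j with n dividing k j, which is m = n / gcd(k, n), so all orbits have m elements and
  there are gcd(k, n) of them. The case k = 0 fits because \<open>gcd 0 n = n\<close>.\<close>

lemma cycle_type_n_cycle_funpow:
  assumes n: "n \<ge> 1"
  shows "cycle_type n (n_cycle n ^^ k) = replicate_mset (gcd k n) (n div gcd k n)"
proof -
  define \<sigma> g m where "\<sigma> = n_cycle n ^^ k" and "g = gcd k n" and "m = n div gcd k n"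
  have gm: "g * m = n" "m \<ge> 1" "g \<ge> 1"
    using n by (auto simp: g_def m_def Suc_le_eq div_greater_zero_iff intro: dvd_imp_le)
  have pow: "(\<sigma> ^^ j) x = (x - 1 + k * j) mod n + 1" if "x \<in> {1..n}" for j x
    using n_cycle_funpow_apply [OF that] by (simp add: \<sigma>_def funpow_mult mult.commute)
  have dvd: "n dvd k * j \<longleftrightarrow> m dvd j" for j
  proof -
    have cop: "coprime m (k div g)"
      using n by (simp add: m_def g_def coprime_commute div_gcd_coprime)
    have "k * j = g * (k div g * j)"
      by (simp add: g_def)
    then have "n dvd k * j \<longleftrightarrow> g * m dvd g * (k div g * j)"
      by (simp only: gm(1))
    also have "\<dots> \<longleftrightarrow> m dvd k div g * j"
      using gm(3) by simp
    finally show ?thesis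
      by (simp only: coprime_dvd_mult_right_iff [OF cop])
  qed
  have perm: "\<sigma> permutes {1..n}" unfolding \<sigma>_def by (rule n_cycle_funpow_permutes)
  then have perm': "permutation \<sigma>" using permutation_permutes by blast
  have card: "card (orbit \<sigma> x) = m" if x: "x \<in> {1..n}" for x
  proof -
    have "n dvd k * m" using dvd by simp
    then have "(x - 1 + k * m) mod n = (x - 1) mod n"
      by (metis add.right_neutral dvd_imp_mod_0 mod_add_right_eq)
    then have "(\<sigma> ^^ m) x = x" using x pow [OF x] by auto
    then have "orbit \<sigma> x = (\<lambda>j. (\<sigma> ^^ j) x) ` {..<m}"
      using orbit_altdef_bounded [of m \<sigma> x] gm by auto
    moreover have "inj_on (\<lambda>j. (\<sigma> ^^ j) x) {..<m}"
    proof (rule linorder_inj_onI)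
      fix i j assume ij: "i < j" "i \<in> {..<m}" "j \<in> {..<m}"
      show "(\<sigma> ^^ i) x \<noteq> (\<sigma> ^^ j) x"
      proof
        assume "(\<sigma> ^^ i) x = (\<sigma> ^^ j) x"
        then have "(x - 1 + k * i) mod n = (x - 1 + k * j) mod n" using pow [OF x] by simp
        moreover have "x - 1 + k * j - (x - 1 + k * i) = k * (j - i)"
          by (simp add: diff_mult_distrib2)
        moreover have "x - 1 + k * i \<le> x - 1 + k * j" using ij by simp
        ultimately have "n dvd k * (j - i)" by (metis mod_eq_dvd_iff_nat)
        then have "m dvd j - i" by (simp add: dvd)
        then show False using ij by (auto dest!: dvd_imp_le)
      qed
    qed auto
    ultimately show ?thesis by (simp add: card_image)
  qed
  have self: "x \<in> orbit \<sigma> x" for x by (rule permutation_self_in_orbit [OF perm'])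
  have Un: "\<Union> (orbit \<sigma> ` {1..n}) = {1..n}"
    using self permutes_orbit_subset [OF perm] by blast
  have disj: "orbit \<sigma> x \<inter> orbit \<sigma> y = {}" if "orbit \<sigma> x \<noteq> orbit \<sigma> y" for x y
  proof (rule ccontr)
    assume "orbit \<sigma> x \<inter> orbit \<sigma> y \<noteq> {}"
    then obtain z where z: "z \<in> orbit \<sigma> x" "z \<in> orbit \<sigma> y" by blast
    then have "x \<in> orbit \<sigma> z" "y \<in> orbit \<sigma> z" using self orbit_swap by metis+
    then have "orbit \<sigma> x = orbit \<sigma> y" using z by (meson orbit_trans subset_antisym subsetI)
    with that show False ..
  qed
  have "m * card (orbit \<sigma> ` {1..n}) = card (\<Union> (orbit \<sigma> ` {1..n}))"
  proof (rule card_partition)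
    show "finite (\<Union> (orbit \<sigma> ` {1..n}))" unfolding Un by simp
  qed (use card disj in auto)
  then have "m * card (orbit \<sigma> ` {1..n}) = m * g" unfolding Un using gm(1) by (simp add: mult.commute)
  then have "card (orbit \<sigma> ` {1..n}) = g" using gm(2) by simp
  moreover have "image_mset card (mset_set (orbit \<sigma> ` {1..n})) =
      image_mset (\<lambda>_. m) (mset_set (orbit \<sigma> ` {1..n}))"
    using card by (intro image_mset_cong) auto
  ultimately show ?thesis
    by (simp add: cycle_type_def image_mset_const_eq \<sigma>_def g_def m_def)
qed

definition lie_root :: "nat set \<Rightarrow> nat \<Rightarrow> complex" where
  "lie_root S n = exp (2 * of_real pi * \<i> / of_nat n * of_nat (Q_num S n))"

lemma lie_root_power: "n \<ge> 1 \<Longrightarrow> lie_root S n ^ n = 1"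
  using exp_integer_2pi [of "of_nat (Q_num S n)"]
  by (simp add: lie_root_def exp_of_nat_mult [symmetric] mult_ac)

text \<open>Exponents giving the same power of the n-cycle agree modulo n, and the nth power of the
  root is 1, so the \<open>THE\<close> has a unique candidate.\<close>

lemma lie_character_funpow:
  assumes n: "n \<ge> 1"
  shows "lie_character S n (n_cycle n ^^ k) = lie_root S n ^ k"
proof -
  have *: "lie_root S n ^ l = lie_root S n ^ (l mod n)" for l
    using lie_root_power [OF n, of S]
    by (metis mult_1 mult_div_mod_eq power_add power_mult power_one)
  show ?thesis
    unfolding lie_character_def lie_root_def [symmetric]
    using * by (intro the_equality) (auto simp: n_cycle_funpow_eq_iff [OF n], metis)
qed

lemma Lie_eq:
  assumes n: "n \<ge> 1"
  shows "Lie S n = mconst (1 / of_nat n) *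
    (\<Sum>j<n. mconst (lie_root S n ^ j) * p_fun (n div gcd j n) ^ gcd j n)"
proof -
  let ?H = "cyclic_subgroup n"
  have H: "?H = (\<lambda>k. n_cycle n ^^ k) ` {..<n}" by (rule cyclic_subgroup_eq [OF n])
  have inj: "inj_on (\<lambda>k. n_cycle n ^^ k) {..<n}" by (rule inj_on_n_cycle_funpow [OF n])
  have "Lie S n = mconst (1 / of_nat (card ?H)) *
      (\<Sum>h\<in>?H. mconst (lie_character S n h) * p_part (cycle_type n h))"
    unfolding Lie_def
  proof (rule frobenius_ch_induced_module [OF cyclic_subgroup_subgroup])
    show "lie_character S n (h \<circ> k) = lie_character S n h * lie_character S n k"
      if "h \<in> ?H" "k \<in> ?H" for h k
      using that by (auto simp: H lie_character_funpow [OF n] power_add simp flip: funpow_add)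
  qed
  also have "\<dots> = mconst (1 / of_nat n) *
      (\<Sum>j<n. mconst (lie_root S n ^ j) * p_part (cycle_type n (n_cycle n ^^ j)))"
    unfolding H by (simp add: sum.reindex [OF inj] card_image [OF inj] lie_character_funpow [OF n])
  finally show ?thesis
    by (simp add: cycle_type_n_cycle_funpow [OF n] part_prod_def image_replicate_mset prod_mset_replicate_mset)
qed

section \<open>A sum of roots of unity\<close>

lemma one_in_P_set: "1 \<in> P_set S"
  by (simp add: P_set_def)

lemma P_set_mult: "x \<in> P_set S \<Longrightarrow> y \<in> P_set S \<Longrightarrow> x * y \<in> P_set S"
  by (auto simp: P_set_def prime_dvd_mult_iff)

lemma P_set_dvd: "x \<in> P_set S \<Longrightarrow> d dvd x \<Longrightarrow> d \<in> P_set S"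
  by (auto simp: P_set_def Suc_le_eq intro: dvd_trans dvd_pos_nat)

lemma Q_num_in:
  assumes "n \<ge> 1"
  shows "Q_num S n \<in> P_set S" "Q_num S n dvd n"
proof -
  have "finite {d. d dvd n \<and> d \<in> P_set S}" using assms by simp
  moreover have "1 \<in> {d. d dvd n \<and> d \<in> P_set S}" using one_in_P_set by simp
  ultimately have "Q_num S n \<in> {d. d dvd n \<and> d \<in> P_set S}"
    unfolding Q_num_def by (metis Max_in empty_iff)
  then show "Q_num S n \<in> P_set S" "Q_num S n dvd n" by auto
qed

lemma le_Q_num:
  assumes "n \<ge> 1" "d dvd n" "d \<in> P_set S"
  shows "d \<le> Q_num S n"
  unfolding Q_num_def using assms by (intro Max_ge) auto

text \<open>By maximality: such a prime in \<open>S\<close> could be multiplied into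
  \<open>Q_num S n\<close> to give a larger admissible divisor.\<close>

lemma prime_cofactor_Q_num:
  assumes n: "n \<ge> 1" and p: "prime p" "p dvd n div Q_num S n"
  shows "p \<notin> S"
proof
  assume "p \<in> S"
  then have "p \<in> P_set S"
    using p(1) by (auto simp: P_set_def Suc_le_eq prime_gt_0_nat dest: primes_dvd_imp_eq)
  then have "Q_num S n * p \<in> P_set S" using Q_num_in(1) [OF n] P_set_mult by blast
  moreover have "Q_num S n * p dvd n"
    using p(2) Q_num_in(2) [OF n, of S] by (metis dvd_mult_div_cancel mult_dvd_mono dvd_refl)
  ultimately have "Q_num S n * p \<le> Q_num S n" using le_Q_num [OF n] by blast
  moreover have "Q_num S n > 0" using Q_num_in(1) [OF n, of S] by (simp add: P_set_def)
  ultimately show False using prime_gt_1_nat [OF p(1)] by simp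
qed

lemma coprime_cofactor_Q_num:
  assumes "n \<ge> 1" "d \<in> P_set S"
  shows "coprime d (n div Q_num S n)"
proof (rule ccontr)
  assume "\<not> coprime d (n div Q_num S n)"
  then obtain p where "prime p" "p dvd d" "p dvd n div Q_num S n"
    by (metis coprime_iff_gcd_eq_1 gcd_nat.boundedE prime_factor_nat)
  then show False using prime_cofactor_Q_num [OF assms(1)] assms(2) by (auto simp: P_set_def)
qed

text \<open>The cofactor of \<open>Q_num S n\<close> is coprime to everything in
  \<open>P_set S\<close>, so the divisor that is largest by size is also largest by
  divisibility.\<close>

lemma dvd_Q_num:
  assumes n: "n \<ge> 1" and d: "d dvd n" "d \<in> P_set S"
  shows "d dvd Q_num S n"
proof -
  have "d dvd Q_num S n * (n div Q_num S n)"
    using d(1) Q_num_in(2) [OF n] by simp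
  then show ?thesis
    using coprime_cofactor_Q_num [OF n d(2)] by (simp add: coprime_dvd_mult_left_iff)
qed

text \<open>Used to express \<open>Q_num S (N div g)\<close> through \<open>Q_num S N\<close> and
  \<open>Q_num S g\<close>, so that its dependence on g can be studied on g alone.\<close>

lemma Q_num_mult:
  assumes x: "x \<ge> 1" and y: "y \<ge> 1"
  shows "Q_num S (x * y) = Q_num S x * Q_num S y"
proof (rule dvd_antisym)
  have xy: "x * y \<ge> 1" using x y by simp
  let ?Q = "Q_num S (x * y)"
  have "x * y = (Q_num S x * Q_num S y) * (y div Q_num S y) * (x div Q_num S x)"
  proof -
    have "(Q_num S x * Q_num S y) * (y div Q_num S y) * (x div Q_num S x) =
        (Q_num S x * (x div Q_num S x)) * (Q_num S y * (y div Q_num S y))"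
      by (simp only: mult_ac)
    then show ?thesis
      using Q_num_in(2) [OF x, of S] Q_num_in(2) [OF y, of S] by simp
  qed
  moreover have "?Q dvd x * y" by (rule Q_num_in [OF xy])
  moreover have "coprime ?Q (x div Q_num S x)" "coprime ?Q (y div Q_num S y)"
    using coprime_cofactor_Q_num x y Q_num_in(1) [OF xy] by blast+
  ultimately show "?Q dvd Q_num S x * Q_num S y"
    by (metis coprime_dvd_mult_left_iff)
  show "Q_num S x * Q_num S y dvd ?Q"
    using x y by (intro dvd_Q_num [OF xy] mult_dvd_mono P_set_mult Q_num_in)
qed

lemma Q_num_cong:
  assumes "\<And>d. d \<in> P_set S \<Longrightarrow> d dvd m \<longleftrightarrow> d dvd n"
  shows "Q_num S m = Q_num S n"
  unfolding Q_num_def using assms by (intro arg_cong [of _ _ Max]) auto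

text \<open>
  The exponent is constant along \<open>l \<mapsto> l + Q\<^sub>e\<close>, and the sum along each such orbit is a full sum of
  \<open>e/Q\<^sub>e\<close>-th roots of unity to a power prime to \<open>e/Q\<^sub>e\<close>, hence zero unless \<open>e = Q\<^sub>e\<close>.
\<close>

lemma sum_roots_of_unity_Q_num:
  assumes N: "N \<ge> 1" and e: "e dvd N"
  shows "(\<Sum>l<e. exp (2 * of_real pi * \<i> * of_nat (l * Q_num S (N div gcd l e)) / of_nat e)) =
    (if e \<in> P_set S then of_nat e else 0)"
proof -
  have e1: "e \<ge> 1" using N e dvd_pos_nat [of N e] by simp
  define a b where "a = Q_num S e" and "b = e div Q_num S e"
  have aP: "a \<in> P_set S" and ab: "a * b = e" using Q_num_in [OF e1, of S] by (simp_all add: a_def b_def)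
  have a1: "a \<ge> 1" using aP by (simp add: P_set_def)
  have b1: "b \<ge> 1" using ab e1 by (cases b) auto
  define q where "q l = Q_num S (N div gcd l e)" for l
  define w where "w x = exp (2 * of_real pi * \<i> * of_nat x / of_nat e)" for x
  have w_add: "w (x + y) = w x * w y" for x y
    unfolding w_def by (simp add: algebra_simps add_divide_distrib flip: exp_add)
  have w_mult: "w (x * y) = w x ^ y" for x y
    unfolding w_def by (simp add: algebra_simps flip: exp_of_nat_mult)
  have w_eq_1: "w x = 1 \<longleftrightarrow> e dvd x" for x
    unfolding w_def using complex_root_unity_eq_1 [of e x] e1 by simp
  have gN: "gcd l e dvd N" for l using e dvd_trans by blast
  have g1: "gcd l e \<ge> 1" for l using e1 by (simp add: Suc_le_eq)
  have div1: "N div gcd l e \<ge> 1" for l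
    using gN [of l] g1 [of l] N by (simp add: Suc_le_eq div_greater_zero_iff dvd_imp_le)
  have q_split: "q l * Q_num S (gcd l e) = Q_num S N" for l
    unfolding q_def using Q_num_mult [OF div1 g1, of S l l] gN [of l] by simp
  show ?thesis
  proof (cases "e \<in> P_set S")
    case True
    \<comment> \<open>e / gcd(l, e) is a divisor of N / gcd(l, e) in \<open>P_set S\<close>, so it
      divides \<open>q l\<close>; then e divides the whole exponent.\<close>
    have "w (l * q l) = 1" for l
    proof -
      have "e div gcd l e dvd N div gcd l e"
        using e gN [of l] by (metis div_dvd_div gcd_dvd2)
      moreover have "e div gcd l e \<in> P_set S"
        using P_set_dvd [OF True] by (metis dvd_div_mult_self dvd_triv_left gcd_dvd2)
      ultimately have "e div gcd l e dvd q l"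
        unfolding q_def by (rule dvd_Q_num [OF div1])
      then have "gcd l e * (e div gcd l e) dvd l * q l"
        by (intro mult_dvd_mono) auto
      then show ?thesis by (simp add: w_eq_1)
    qed
    then show ?thesis using True by (simp add: w_def q_def)
  next
    case False
    then have "b \<noteq> 1" using aP ab by auto
    then obtain p where p: "prime p" "p dvd b" using prime_factor_nat by blast
    \<comment> \<open>Divisors of e in \<open>P_set S\<close> divide a, so adding a multiple of a to
      l does not change which of them divide the gcd.\<close>
    have q_shift: "q (l + a * m) = q l" for l m
    proof -
      have "Q_num S (gcd (l + a * m) e) = Q_num S (gcd l e)"
      proof (rule Q_num_cong)
        fix d assume d: "d \<in> P_set S"
        have "d dvd e \<Longrightarrow> d dvd a" unfolding a_def by (rule dvd_Q_num [OF e1 _ d])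
        then show "d dvd gcd (l + a * m) e \<longleftrightarrow> d dvd gcd l e"
          by (auto simp: dvd_add_left_iff)
      qed
      then have "q (l + a * m) * Q_num S (gcd l e) = q l * Q_num S (gcd l e)"
        using q_split by metis
      moreover have "Q_num S (gcd l e) \<noteq> 0"
        using Q_num_in(1) [OF g1, of S l] by (auto simp: P_set_def)
      ultimately show ?thesis by simp
    qed
    have inner: "(\<Sum>m<b. w ((l + a * m) * q l)) = 0" for l
    proof -
      \<comment> \<open>v is the ratio of a geometric sum. If v were 1, then b would divide
        \<open>q l\<close>; but b has a prime factor outside \<open>S\<close>, while
        \<open>q l\<close> lies in \<open>P_set S\<close>.\<close>
      define v where "v = w (a * q l)"
      have "v ^ b = w (e * q l)"
        unfolding v_def by (simp flip: w_mult ab add: mult_ac)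
      then have "v ^ b = 1" using w_eq_1 by simp
      moreover have "v \<noteq> 1"
      proof
        assume "v = 1"
        then have "a * b dvd a * q l" by (simp add: v_def w_eq_1 ab)
        then have "p dvd q l" using p(2) a1 dvd_trans by auto
        moreover have "q l \<in> P_set S" unfolding q_def by (rule Q_num_in [OF div1])
        ultimately have "p \<in> S" using p(1) by (auto simp: P_set_def)
        then show False using prime_cofactor_Q_num [OF e1, of p S] p by (simp add: b_def)
      qed
      ultimately have "(\<Sum>m<b. v ^ m) = 0" by (simp add: geometric_sum)
      moreover have "w ((l + a * m) * q l) = w (l * q l) * v ^ m" for m
      proof -
        have "(l + a * m) * q l = l * q l + (a * q l) * m" by (simp add: algebra_simps)
        then show ?thesis by (simp only: w_add w_mult v_def)
      qed
      ultimately show ?thesis by (simp flip: sum_distrib_left)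
    qed
    have "(\<Sum>l<e. w (l * q l)) = (\<Sum>(l, m)\<in>{..<a} \<times> {..<b}. w ((l + a * m) * q (l + a * m)))"
    proof (rule sum.reindex_bij_witness
        [where j = "\<lambda>l. (l mod a, l div a)" and i = "\<lambda>(l, m). l + a * m"])
      fix l assume "l \<in> {..<e}"
      then have "l < a * b" using ab by simp
      then show "(l mod a, l div a) \<in> {..<a} \<times> {..<b}"
        using a1 by (simp add: less_mult_imp_div_less mult.commute)
    next
      fix x assume "x \<in> {..<a} \<times> {..<b}"
      then obtain l m where x: "x = (l, m)" "l < a" "m < b" by auto
      have "l + a * m < a * (m + 1)" using x(2) by simp
      also have "\<dots> \<le> a * b" using x(3) by (intro mult_le_mono2) simp
      finally show "(case x of (l, m) \<Rightarrow> l + a * m) \<in> {..<e}" using ab x(1) by simp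
      show "(\<lambda>l. (l mod a, l div a)) (case x of (l, m) \<Rightarrow> l + a * m) = x" using x by simp
    qed auto
    also have "\<dots> = (\<Sum>l<a. \<Sum>m<b. w ((l + a * m) * q l))"
      by (simp add: sum.cartesian_product q_shift)
    also have "\<dots> = 0" by (simp add: inner)
    finally show ?thesis using False by (simp add: w_def q_def)
  qed
qed

section \<open>The plethystic logarithm of \<open>Lie\<^sup>S\<close>\<close>

text \<open>The sign s lets both identities share one computation: s = 1 gives \<open>Lie\<close>,
  and s = -1 gives its alternating omega image. Its exponent is one less than the number of power
  sum factors.\<close>

definition signed_Lie :: "nat set \<Rightarrow> complex \<Rightarrow> nat \<Rightarrow> symf" where
  "signed_Lie S s n = mconst (1 / of_nat n) *
    (\<Sum>j<n. mconst (lie_root S n ^ j * s ^ (gcd j n - 1)) * p_fun (n div gcd j n) ^ gcd j n)"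

lemma Lie_eq_signed: "n \<ge> 1 \<Longrightarrow> Lie S n = signed_Lie S 1 n"
  by (simp add: Lie_eq signed_Lie_def)

text \<open>With d g = n, omega multiplies p_d^g by (-1)^((d-1) g) = (-1)^(n-g). Together with
  (-1)^(n-1) this leaves the sign (-1)^(g-1).\<close>

lemma omega_alt_Lie_eq_signed:
  assumes n: "n \<ge> 1"
  shows "omega_alt (Lie S) n = signed_Lie S (-1) n"
proof -
  let ?b = "\<lambda>n. (-1) ^ (n - 1) * p_fun n"
  note ai = alg_indep_p_fun
  have div1: "n div gcd j n \<ge> 1" for j
    using n by (simp add: Suc_le_eq div_greater_zero_iff dvd_imp_le)
  have p: "p_fun (n div gcd j n) \<in> gen_alg p_fun" for j
    by (rule gen_alg_generator [OF div1])
  have "Lie S n \<in> gen_alg p_fun"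
    unfolding Lie_eq [OF n] by (intro gen_alg_mult gen_alg_mconst gen_alg_sum gen_alg_power p)
  then have "omega (Lie S n) = gen_hom p_fun ?b (Lie S n)"
    by (rule omega_eq)
  also have "\<dots> = mconst (1 / of_nat n) *
      (\<Sum>j<n. mconst (lie_root S n ^ j) * (?b (n div gcd j n)) ^ gcd j n)"
    unfolding Lie_eq [OF n]
    by (simp only: gen_hom_mult [OF ai] gen_hom_mconst [OF ai] gen_hom_sum [OF ai] gen_hom_power [OF ai]
        gen_hom_generator [OF ai div1] gen_alg_mult gen_alg_mconst gen_alg_sum gen_alg_power p)
  finally have "omega_alt (Lie S) n = (-1) ^ (n - 1) * (mconst (1 / of_nat n) *
      (\<Sum>j<n. mconst (lie_root S n ^ j) * (?b (n div gcd j n)) ^ gcd j n))"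
    by (simp add: omega_alt_def)
  also have "\<dots> = mconst (1 / of_nat n) *
      (\<Sum>j<n. (-1) ^ (n - 1) * (mconst (lie_root S n ^ j) * (?b (n div gcd j n)) ^ gcd j n))"
    by (simp add: sum_distrib_left mult_ac)
  also have "\<dots> = signed_Lie S (-1) n"
    unfolding signed_Lie_def
  proof (intro arg_cong [of _ _ "(*) _"] sum.cong refl)
    fix j
    define g d where "g = gcd j n" and "d = n div gcd j n"
    have dg: "d * g = n" "g \<ge> 1" "d \<ge> 1"
      using n div1 [of j] by (simp_all add: g_def d_def Suc_le_eq)
    then have "g \<le> n" using mult_le_mono1 [of 1 d g] by simp
    have dg': "(d - 1) * g = n - g" using dg(1) by (simp add: diff_mult_distrib)
    have parity: "even (n - 1 + (n - g)) \<longleftrightarrow> even (g - 1)"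
      using dg n \<open>g \<le> n\<close> by (cases "even g"; cases "even n") auto
    have "(-1 :: symf) ^ (n - 1) * ((-1) ^ (d - 1)) ^ g = (-1) ^ (n - 1 + (n - g))"
      by (simp only: power_mult [symmetric] power_add dg')
    also have "\<dots> = (-1) ^ (g - 1)"
      unfolding minus_one_power_iff parity ..
    finally have sign: "(-1 :: symf) ^ (n - 1) * ((-1) ^ (d - 1)) ^ g = (-1) ^ (g - 1)" .
    have "(-1) ^ (n - 1) * (mconst (lie_root S n ^ j) * (?b d) ^ g) =
        mconst (lie_root S n ^ j) * ((-1) ^ (n - 1) * ((-1) ^ (d - 1)) ^ g) * p_fun d ^ g"
      by (simp only: power_mult_distrib mult_ac)
    then have "(-1) ^ (n - 1) * (mconst (lie_root S n ^ j) * (?b d) ^ g) =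
        mconst (lie_root S n ^ j) * (-1) ^ (g - 1) * p_fun d ^ g"
      unfolding sign .
    then show "(-1) ^ (n - 1) * (mconst (lie_root S n ^ j) * (?b (n div gcd j n)) ^ gcd j n) =
        mconst (lie_root S n ^ j * (-1) ^ (gcd j n - 1)) * p_fun (n div gcd j n) ^ gcd j n"
      by (simp add: g_def d_def mconst_mult mconst_power mconst_uminus)
  qed
  finally show ?thesis .
qed

text \<open>The index is kept in the form \<open>k * n div gcd j n\<close> because k n will be the
  fixed number N of a divisor sum.\<close>

lemma p_plethysm_signed_Lie:
  assumes "k \<ge> 1" "n \<ge> 1"
  shows "of_nat n * p_plethysm k (signed_Lie S s n) =
    (\<Sum>j<n. mconst (lie_root S n ^ j * s ^ (gcd j n - 1)) * p_fun (k * n div gcd j n) ^ gcd j n)"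
proof -
  have "p_plethysm k (signed_Lie S s n) = mconst (1 / of_nat n) *
     (\<Sum>j<n. mconst (lie_root S n ^ j * s ^ (gcd j n - 1)) * p_fun (k * n div gcd j n) ^ gcd j n)"
    unfolding signed_Lie_def using assms(1)
    by (simp only: p_plethysm_mult p_plethysm_mconst p_plethysm_sum p_plethysm_power p_plethysm_p_fun
        div_mult_swap [OF gcd_dvd2])
  then show ?thesis
    using mconst_inverse_cancel [of n] assms(2) by (simp add: mult.left_commute)
qed

text \<open>
  The involution \<open>(u, j) \<mapsto> (r, l)\<close> with \<open>r = gcd(j, N/u)\<close> and \<open>r l = u j\<close> on the pairs with \<open>u | N\<close> and
  \<open>0 \<le> j < N/u\<close> collects the terms with the same power sum.
\<close>

lemma sum_p_plethysm_signed_Lie: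
  assumes N: "N \<ge> 1"
  shows "(\<Sum>i | i dvd N. of_nat i * p_plethysm (N div i) (signed_Lie S s i)) =
    (\<Sum>i | i dvd N. of_nat i *
      (if i \<in> P_set S then mconst (s ^ (N div i - 1)) * p_fun i ^ (N div i) else 0))"
proof -
  define D where "D = (SIGMA u:{u. u dvd N}. {..<N div u})"
  define \<tau> where "\<tau> = (\<lambda>(u, j). (gcd j (N div u), j * u div gcd j (N div u)))"
  \<comment> \<open>Numerator, index of \<open>Q_num\<close> and denominator are separate arguments,
    so that fractions over N/u, N and N/r can be compared while the index stays fixed.\<close>
  define E where "E l u N' = exp (2 * of_real pi * \<i> * of_nat (l * Q_num S u) / of_nat N')" for l u N' :: nat
  have fin: "finite {u. u dvd N}" using N by simp
  have pos: "u \<ge> 1" "N div u \<ge> 1" if "u dvd N" for u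
    using that N dvd_imp_le [of u N] dvd_pos_nat [of N u]
    by (simp_all add: Suc_le_eq div_greater_zero_iff)
  have flip: "(\<Sum>i | i dvd N. f i (N div i)) = (\<Sum>u | u dvd N. f (N div u) u)"
    for f :: "nat \<Rightarrow> nat \<Rightarrow> symf"
    by (rule sum.reindex_bij_witness [where i = "\<lambda>u. N div u" and j = "\<lambda>u. N div u"])
       (use N in \<open>auto simp: div_div_eq_right\<close>)
  have root: "lie_root S i ^ j = E j i i" for i j
    unfolding lie_root_def E_def by (simp add: mult_ac flip: exp_of_nat_mult)
  have \<tau>: "\<tau> (u, j) \<in> D \<and> \<tau> (\<tau> (u, j)) = (u, j) \<and> fst (\<tau> (u, j)) * snd (\<tau> (u, j)) = u * j"
    if uj: "(u, j) \<in> D" for u j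
  proof -
    define n r where "n = N div u" and "r = gcd j n"
    have u: "u dvd N" "u \<ge> 1" "n \<ge> 1" "j < n" "u * n = N"
      using uj pos [of u] by (auto simp: D_def n_def)
    have r1: "r \<ge> 1" using u(3) by (simp add: r_def Suc_le_eq)
    define j' n' where "j' = j div r" and "n' = n div r"
    have jn: "j = j' * r" "n = n' * r" by (simp_all add: j'_def n'_def r_def)
    have cop: "coprime j' n'"
      using u(3) unfolding j'_def n'_def r_def by (intro div_gcd_coprime) auto
    have \<tau>uj: "\<tau> (u, j) = (r, j' * u)"
      using r1 by (simp add: \<tau>_def r_def [symmetric] n_def [symmetric]) (simp add: jn(1) mult_ac)
    have Nr: "N div r = n' * u" "r dvd N"
      using r1 u(5) jn(2) by auto
    have "j' < n'" using u(4) jn by simp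
    then have "j' * u < n' * u" using u(2) by simp
    then have "\<tau> (u, j) \<in> D" using Nr by (simp add: \<tau>uj D_def)
    \<comment> \<open>Hence the gcd formed from the new pair recovers u, which makes the map an
      involution.\<close>
    moreover have "gcd (j' * u) (n' * u) = u"
      using cop gcd.commute [of n' j'] by (simp add: gcd_mult_right coprime_iff_gcd_eq_1 gcd_mult_distrib_nat [symmetric] mult.commute)
    then have "\<tau> (\<tau> (u, j)) = (u, j)"
      using u(2) by (simp add: \<tau>uj) (simp add: \<tau>_def Nr jn(1) mult_ac)
    moreover have "fst (\<tau> (u, j)) * snd (\<tau> (u, j)) = u * j"
      unfolding \<tau>uj using jn(1) by (simp add: mult_ac)
    ultimately show ?thesis by simp
  qed
  \<comment> \<open>Written over the common denominator N, the exponent \<open>r * l\<close> equals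
    u j, so the same expression can be read from either pair. Here r is the number of power sum
    factors, and u recovers the degree N/u of the original term.\<close>
  define F where "F r u l = mconst (E (r * l) (N div u) N * s ^ (r - 1)) * p_fun (N div r) ^ r"
    for r u l :: nat
  have "(\<Sum>i | i dvd N. of_nat i * p_plethysm (N div i) (signed_Lie S s i)) =
      (\<Sum>u | u dvd N. of_nat (N div u) * p_plethysm u (signed_Lie S s (N div u)))"
    by (rule flip)
  also have "\<dots> = (\<Sum>u | u dvd N. \<Sum>j<N div u. F (gcd j (N div u)) u (j * u div gcd j (N div u)))"
  proof (intro sum.cong refl)
    fix u assume "u \<in> {u. u dvd N}"
    then have u: "u dvd N" by simp
    have "E j (N div u) (N div u) = E (j * u) (N div u) N" for j
    proof -
      have "of_nat N = (of_nat u * of_nat (N div u) :: complex)"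
        using u by (metis dvd_mult_div_cancel of_nat_mult)
      then show ?thesis using pos [OF u] by (simp add: E_def mult_ac)
    qed
    moreover have "gcd j (N div u) * (j * u div gcd j (N div u)) = j * u" for j
      by (simp add: div_mult_swap mult.commute)
    ultimately show "of_nat (N div u) * p_plethysm u (signed_Lie S s (N div u)) =
        (\<Sum>j<N div u. F (gcd j (N div u)) u (j * u div gcd j (N div u)))"
      using u by (simp add: p_plethysm_signed_Lie [OF pos [OF u]] F_def root)
  qed
  also have "\<dots> = (\<Sum>(u, j)\<in>D. F (gcd j (N div u)) u (j * u div gcd j (N div u)))"
    unfolding D_def by (rule sum.Sigma) (auto simp: fin)
  also have "\<dots> = (\<Sum>(r, l)\<in>D. F r (gcd l (N div r)) l)"
  proof (rule sum.reindex_bij_witness [where i = \<tau> and j = \<tau>])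
    fix x assume x: "x \<in> D"
    obtain u j where uj: "x = (u, j)" by fastforce
    show "\<tau> (\<tau> x) = x" "\<tau> (\<tau> x) = x" "\<tau> x \<in> D" "\<tau> x \<in> D" using \<tau> x by (auto simp: uj)
    have "fst (\<tau> (\<tau> x)) = u" using \<tau> x by (auto simp: uj)
    then show "(case \<tau> x of (r, l) \<Rightarrow> F r (gcd l (N div r)) l) =
        (case x of (u, j) \<Rightarrow> F (gcd j (N div u)) u (j * u div gcd j (N div u)))"
      by (simp add: uj \<tau>_def)
  qed
  also have "\<dots> = (\<Sum>r | r dvd N. \<Sum>l<N div r. F r (gcd l (N div r)) l)"
    unfolding D_def by (rule sum.Sigma [symmetric]) (auto simp: fin)
  also have "\<dots> = (\<Sum>r | r dvd N. of_nat (N div r) *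
      (if N div r \<in> P_set S then mconst (s ^ (r - 1)) * p_fun (N div r) ^ r else 0))"
  proof (intro sum.cong refl)
    fix r assume "r \<in> {r. r dvd N}"
    then have r: "r dvd N" by simp
    let ?e = "N div r"
    have "E (r * l) u N = E l u ?e" for l u
    proof -
      have "of_nat N = (of_nat r * of_nat ?e :: complex)"
        using r by (metis dvd_mult_div_cancel of_nat_mult)
      then show ?thesis using pos [OF r] by (simp add: E_def mult_ac)
    qed
    then have "(\<Sum>l<?e. F r (gcd l ?e) l) =
        mconst (\<Sum>l<?e. E l (N div gcd l ?e) ?e) * (mconst (s ^ (r - 1)) * p_fun ?e ^ r)"
      unfolding F_def mconst_sum sum_distrib_right by (simp add: mconst_mult mult.assoc)
    also have "(\<Sum>l<?e. E l (N div gcd l ?e) ?e) = (if ?e \<in> P_set S then of_nat ?e else 0)"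
      unfolding E_def by (rule sum_roots_of_unity_Q_num [OF N]) (use r in auto)
    finally show "(\<Sum>l<?e. F r (gcd l ?e) l) = of_nat ?e *
        (if ?e \<in> P_set S then mconst (s ^ (r - 1)) * p_fun ?e ^ r else 0)"
      by (simp add: mconst_of_nat)
  qed
  also have "\<dots> = (\<Sum>i | i dvd N. of_nat i *
      (if i \<in> P_set S then mconst (s ^ (N div i - 1)) * p_fun i ^ (N div i) else 0))"
    by (rule flip [symmetric])
  finally show ?thesis .
qed

section \<open>Comparison of the series with Euler products\<close>

lemma H_series_eq_euler_series: "H_series q = euler_series (\<lambda>i m. plethysm (h_fun m) (q i))"
  by (simp add: H_series_def euler_series_def H_part_def part_weight_def)

text \<open>The recursion for \<open>a\<close> with i in \<open>P_set S\<close> is the one satisfied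
  by exp(y + s y^2/2 + s^2 y^3/3 + ...) with y = t^i p_i. This is 1/(1 - y) for s = 1 and 1 + y for
  s = -1.\<close>

lemma H_series_eq_euler_seriesI:
  assumes q: "\<And>n. n \<ge> 1 \<Longrightarrow> q n = signed_Lie S s n" and a0: "\<And>i. a i 0 = 1"
    and a: "\<And>i m. i \<ge> 1 \<Longrightarrow> m \<ge> 1 \<Longrightarrow> of_nat m * a i m =
      (\<Sum>k=1..m. (if i \<in> P_set S then mconst (s ^ (k - 1)) * p_fun i ^ k else 0) * a i (m - k))"
  shows "H_series q = euler_series a"
  unfolding H_series_eq_euler_series
proof (rule euler_series_eqI [OF _ a0 newton_plethysm_h_fun a])
  show "plethysm (h_fun 0) (q i) = 1" for i by (rule plethysm_h_fun_0)
  fix N :: nat assume N: "N \<ge> 1"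
  \<comment> \<open>At i = 0 the assumption on q is silent, but the factor \<open>of_nat i\<close>
    vanishes.\<close>
  have "of_nat i * p_plethysm (N div i) (q i) = of_nat i * p_plethysm (N div i) (signed_Lie S s i)" for i
    using q [of i] by (cases "i = 0") auto
  then show "(\<Sum>i | i dvd N. of_nat i * p_plethysm (N div i) (q i)) = (\<Sum>i | i dvd N. of_nat i *
      (if i \<in> P_set S then mconst (s ^ (N div i - 1)) * p_fun i ^ (N div i) else 0))"
    using sum_p_plethysm_signed_Lie [OF N] by simp
qed

definition geom_coeff :: "nat set \<Rightarrow> nat \<Rightarrow> nat \<Rightarrow> symf" where
  "geom_coeff S i m = (if i \<in> P_set S then p_fun i ^ m else if m = 0 then 1 else 0)"

definition binom_coeff :: "nat set \<Rightarrow> nat \<Rightarrow> nat \<Rightarrow> symf" where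
  "binom_coeff S i m = (if m = 0 then 1 else if m = 1 \<and> i \<in> P_set S then p_fun i else 0)"

lemma H_series_Lie: "H_series (Lie S) = euler_series (geom_coeff S)"
proof (rule H_series_eq_euler_seriesI [where S = S and s = 1])
  show "of_nat m * geom_coeff S i m = (\<Sum>k=1..m.
      (if i \<in> P_set S then mconst (1 ^ (k - 1)) * p_fun i ^ k else 0) * geom_coeff S i (m - k))"
    if "m \<ge> 1" for i m
    using that by (auto simp: geom_coeff_def simp flip: power_add)
qed (auto simp: Lie_eq_signed geom_coeff_def)

lemma H_series_omega_alt_Lie: "H_series (omega_alt (Lie S)) = euler_series (binom_coeff S)"
proof (rule H_series_eq_euler_seriesI [where S = S and s = "-1"])
  show "of_nat m * binom_coeff S i m = (\<Sum>k=1..m.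
      (if i \<in> P_set S then mconst ((-1) ^ (k - 1)) * p_fun i ^ k else 0) * binom_coeff S i (m - k))"
    if m: "m \<ge> 1" for i m
  proof (cases "i \<in> P_set S")
    case i: True
    show ?thesis
    proof (cases "m = 1")
      case False
      then obtain d where d: "m = Suc (Suc d)"
        using m by (metis One_nat_def Suc_le_D le_antisym not_less_eq_eq old.nat.exhaust)
      \<comment> \<open>For m \<ge> 2 only k = m - 1 and k = m meet a nonzero coefficient. Both
        terms are p_i^m up to sign, and the signs are opposite.\<close>
      have "(\<Sum>k=1..m. mconst ((-1) ^ (k - 1)) * p_fun i ^ k * binom_coeff S i (m - k)) =
          (\<Sum>k\<in>{Suc d, Suc (Suc d)}. mconst ((-1) ^ (k - 1)) * p_fun i ^ k * binom_coeff S i (m - k))"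
        by (rule sum.mono_neutral_right) (auto simp: d binom_coeff_def)
      also have "\<dots> = 0" using i by (simp add: d binom_coeff_def mconst_power mconst_uminus)
      finally show ?thesis using i by (simp add: d binom_coeff_def)
    qed (use i in \<open>simp add: binom_coeff_def\<close>)
  qed (use m in \<open>simp add: binom_coeff_def\<close>)
qed (auto simp: omega_alt_Lie_eq_signed binom_coeff_def)

lemma ring_inverse_eqI:
  assumes "a * b = 1" shows "ring_inverse a = b"
  unfolding ring_inverse_def
proof (rule the_equality)
  show "a * b = 1" by (rule assms)
next
  fix c assume "a * c = 1"
  then have "b * (a * c) = b" by simp
  moreover have "b * (a * c) = c" using assms by (simp add: mult_ac flip: mult.assoc)
  ultimately show "c = b" by simp
qed

text \<open>Telescoping: in the product with 1 - t^i p_i, the coefficient p_i^m at t^(i m) cancels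
  against p_i times the coefficient one step of length i earlier, except at m = 0.\<close>

lemma euler_factor_geom_coeff:
  assumes "i \<ge> 1"
  shows "euler_factor (geom_coeff S) i =
    (if i \<in> P_set S then ring_inverse (1 - fps_X ^ i * fps_const (p_fun i)) else 1)"
proof (cases "i \<in> P_set S")
  case True
  have "(1 - fps_X ^ i * fps_const (p_fun i)) * euler_factor (geom_coeff S) i = 1"
  proof (rule fps_ext)
    fix n
    have shift: "i dvd n - i \<longleftrightarrow> i dvd n" "n div i = Suc ((n - i) div i)" if "i \<le> n"
      using that assms le_div_geq [of i n] by (auto simp: dvd_minus_self)
    have "fps_nth ((1 - fps_X ^ i * fps_const (p_fun i)) * euler_factor (geom_coeff S) i) n =
        fps_nth (euler_factor (geom_coeff S) i) n -
        (if n < i then 0 else p_fun i * fps_nth (euler_factor (geom_coeff S) i) (n - i))"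
      by (simp add: left_diff_distrib mult.assoc fps_X_power_mult_nth)
    also have "\<dots> = fps_nth 1 n"
    proof (cases "n < i")
      case small: True
      then have "i dvd n \<longleftrightarrow> n = 0" using assms by (auto dest: dvd_imp_le)
      with small show ?thesis using True by (simp add: euler_factor_def geom_coeff_def)
    next
      case False
      then show ?thesis using True shift assms by (simp add: euler_factor_def geom_coeff_def)
    qed
    finally show "fps_nth ((1 - fps_X ^ i * fps_const (p_fun i)) * euler_factor (geom_coeff S) i) n =
      fps_nth 1 n" .
  qed
  then show ?thesis using True ring_inverse_eqI by metis
next
  case False
  then show ?thesis
    using assms by (intro fps_ext) (auto simp: euler_factor_def geom_coeff_def dvd_div_eq_0_iff)
qed

lemma euler_factor_binom_coeff:
  assumes "i \<ge> 1"
  shows "euler_factor (binom_coeff S) i =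
    (if i \<in> P_set S then 1 + fps_X ^ i * fps_const (p_fun i) else 1)"
proof (rule fps_ext)
  fix n
  have "i dvd n \<and> n div i = 1 \<longleftrightarrow> n = i"
    using assms by (auto simp: dvd_def)
  moreover have "i dvd n \<and> n div i = 0 \<longleftrightarrow> n = 0"
    using assms by (auto simp: dvd_div_eq_0_iff)
  ultimately show "fps_nth (euler_factor (binom_coeff S) i) n =
      fps_nth (if i \<in> P_set S then 1 + fps_X ^ i * fps_const (p_fun i) else 1) n"
    using assms by (auto simp: euler_factor_def binom_coeff_def fps_X_power_mult_nth)
qed

lemma p_part_eq_prod: "p_part \<mu> = (\<Prod>i\<in>set_mset \<mu>. p_fun i ^ count \<mu> i)"
  by (simp add: part_prod_def image_prod_mset_multiplicity)

theorem theorem3p5: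
  fixes S :: "nat set"
  assumes "\<forall>p\<in>S. prime p"
  shows "((\<lambda>n. if n \<in> P_set S then ring_inverse (1 - fps_X ^ n * fps_const (p_fun n)) else 1)
            has_prod H_series (Lie S)) \<and>
         ((\<lambda>\<mu>. fps_X ^ (\<Sum>\<^sub># \<mu>) * fps_const (p_part \<mu>)) has_sum H_series (Lie S))
            {\<mu> \<in> Par. set_mset \<mu> \<subseteq> P_set S} \<and>
         ((\<lambda>n. if n \<in> P_set S then 1 + fps_X ^ n * fps_const (p_fun n) else 1)
            has_prod H_series (omega_alt (Lie S))) \<and>
         ((\<lambda>\<mu>. fps_X ^ (\<Sum>\<^sub># \<mu>) * fps_const (p_part \<mu>)) has_sum H_series (omega_alt (Lie S)))
            {\<mu> \<in> DPar. set_mset \<mu> \<subseteq> P_set S}"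
proof (intro conjI)
  \<comment> \<open>The products also run over the index 0, whose factor is therefore 1.\<close>
  have zero: "0 \<notin> P_set S" by (simp add: P_set_def)
  show "(\<lambda>n. if n \<in> P_set S then ring_inverse (1 - fps_X ^ n * fps_const (p_fun n)) else 1)
      has_prod H_series (Lie S)"
    unfolding H_series_Lie
    by (rule has_prod_euler_series) (simp_all add: zero euler_factor_geom_coeff geom_coeff_def)
  show "(\<lambda>n. if n \<in> P_set S then 1 + fps_X ^ n * fps_const (p_fun n) else 1)
      has_prod H_series (omega_alt (Lie S))"
    unfolding H_series_omega_alt_Lie
    by (rule has_prod_euler_series) (simp_all add: zero euler_factor_binom_coeff binom_coeff_def)
  show "((\<lambda>\<mu>. fps_X ^ (\<Sum>\<^sub># \<mu>) * fps_const (p_part \<mu>)) has_sum H_series (Lie S))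
      {\<mu> \<in> Par. set_mset \<mu> \<subseteq> P_set S}"
    unfolding H_series_Lie
  proof (rule has_sum_euler_series)
    show "part_weight (geom_coeff S) \<mu> = 0" if "\<mu> \<in> Par - {\<mu> \<in> Par. set_mset \<mu> \<subseteq> P_set S}" for \<mu>
      using that by (auto simp: part_weight_def geom_coeff_def intro!: prod_zero)
    show "fps_X ^ (\<Sum>\<^sub># \<mu>) * fps_const (p_part \<mu>) =
        fps_X ^ (\<Sum>\<^sub># \<mu>) * fps_const (part_weight (geom_coeff S) \<mu>)"
      if "\<mu> \<in> {\<mu> \<in> Par. set_mset \<mu> \<subseteq> P_set S}" for \<mu>
    proof -
      have "p_part \<mu> = part_weight (geom_coeff S) \<mu>"
        unfolding part_weight_def p_part_eq_prod using that
        by (intro prod.cong) (auto simp: geom_coeff_def)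
      then show ?thesis by simp
    qed
  qed auto
  show "((\<lambda>\<mu>. fps_X ^ (\<Sum>\<^sub># \<mu>) * fps_const (p_part \<mu>)) has_sum H_series (omega_alt (Lie S)))
      {\<mu> \<in> DPar. set_mset \<mu> \<subseteq> P_set S}"
    unfolding H_series_omega_alt_Lie
  proof (rule has_sum_euler_series)
    show "part_weight (binom_coeff S) \<mu> = 0"
      if \<mu>: "\<mu> \<in> Par - {\<mu> \<in> DPar. set_mset \<mu> \<subseteq> P_set S}" for \<mu>
    proof -
      \<comment> \<open>Outside the index set a part is repeated or not in \<open>P_set S\<close>,
        and either gives a zero factor of the weight.\<close>
      have "\<exists>i\<in>#\<mu>. count \<mu> i \<noteq> 1 \<or> i \<notin> P_set S"
      proof (rule ccontr)
        assume *: "\<not> (\<exists>i\<in>#\<mu>. count \<mu> i \<noteq> 1 \<or> i \<notin> P_set S)"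
        then have "count \<mu> i \<le> 1" for i by (cases "i \<in># \<mu>") (auto simp: not_in_iff)
        then show False using * \<mu> by (auto simp: DPar_def)
      qed
      then show ?thesis
        by (auto simp: part_weight_def binom_coeff_def intro!: prod_zero)
    qed
    show "fps_X ^ (\<Sum>\<^sub># \<mu>) * fps_const (p_part \<mu>) =
        fps_X ^ (\<Sum>\<^sub># \<mu>) * fps_const (part_weight (binom_coeff S) \<mu>)"
      if \<mu>: "\<mu> \<in> {\<mu> \<in> DPar. set_mset \<mu> \<subseteq> P_set S}" for \<mu>
    proof -
      have "count \<mu> i = 1" if "i \<in># \<mu>" for i
        using \<mu> that by
          (metis (mono_tags, lifting) DPar_def count_greater_eq_one_iff le_antisym mem_Collect_eq)
      then have "p_part \<mu> = part_weight (binom_coeff S) \<mu>"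
        unfolding part_weight_def p_part_eq_prod using \<mu>
        by (intro prod.cong) (auto simp: binom_coeff_def)
      then show ?thesis by simp
    qed
  qed (auto simp: DPar_def)
qed

end
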